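(* For every standard expression $e$ with $\varnothing\vdash e:\mathtt{bool}$, every principal $n$, every $P'\subseteq\mathsf{Privileges}$ and every stack $S$ (possibly empty list) such that $\langle n,P'\rangle::S$ is a stack, we have $[\![\varnothing\vdash e:\mathtt{bool}]\!]\,n\,P\,\{\}=[\![\varnothing\vdash e:\mathtt{bool}]\!]_s\,(\langle n,P'\rangle::S)\,\{\}$, where $P=\mathsf{privs}(\langle n,P'\rangle::S)$.
   Context: Fix sets $\mathsf{Principals}$ and $\mathsf{Privileges}$ and an access control list $\mathcal{A}:\mathsf{Principals}\to\mathcal{P}(\mathsf{Privileges})$. Language. Types: $t::=\mathtt{bool}\mid t_1\to t_2$. Expressions: $e::=\mathtt{true}\mid x\mid \mathtt{if}\ e\ \mathtt{then}\ e_1\ \mathtt{else}\ e_2\mid \lambda x.e\mid e_1\,e_2\mid \mathtt{letrec}\ f(x)=e_1\ \mathtt{in}\ e_2\mid \mathtt{signs}\ n\ e\mid \mathtt{dopriv}\ p\ \mathtt{in}\ e\mid \mathtt{check}\ p\ \mathtt{for}\ e\mid \mathtt{test}\ p\ \mathtt{then}\ e_1\ \mathtt{else}\ e_2$ ($n$ a principal, $p$ a privilege). Typing $D\vdash e:t$ is simply typed: $\mathtt{letrec}$ typed by $D,f:t_1\to t_2,x:t_1\vdash e_1:t_2$ and $D,f:t_1\to t_2\vdash e_2:t$; $\mathtt{signs},\mathtt{dopriv},\mathtt{check}$ preserve the body type; $\mathtt{test}$, $\mathtt{if}$ need branches of a common type ($\mathtt{if}$ a $\mathtt{bool}$ guard).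 An expression is standard if for every subexpression $\lambda x.e$ or $\mathtt{letrec}\ f(x)=e\ \mathtt{in}\ e_1$, the body $e$ is of the form $\mathtt{signs}\ n\ e'$. Common. $\bot,\star$ are two distinct values, neither booleans nor functions. For a cpo $C$, $C_{\bot\star}=C\cup\{\bot,\star\}$ with $u\le v$ iff $u=\bot$ or $u=v$ or $u,v\in C$, $u\le v$. "let $d=E_1$ in $E_2$" yields $E_1$ if $E_1\in\{\bot,\star\}$, else $E_2$ with $d:=E_1$; $\mathit{fix}$ is least fixed point; $\{\}$ is the empty environment. Eager semantics. $[\![\mathtt{bool}]\!]=\{\mathsf{true},\mathsf{false}\}$ and $\mathcal{P}(\mathsf{Privileges})$ ordered by equality; $[\![t_1\to t_2]\!]=\mathcal{P}(\mathsf{Privileges})\to[\![t_1]\!]\to[\![t_2]\!]_{\bot\star}$ (continuous, pointwise). $[\![D\vdash e:t]\!]\in\mathsf{Principals}\to\mathcal{P}(\mathsf{Privileges})\to[\![D]\!]\to[\![t]\!]_{\bot\star}$, written $[\![e]\!]nPh$. $P\sqcup_n\{p\}$ is $P\cup\{p\}$ if $p\in\mathcal{A}(n)$, else $P$. Equations: $[\![\mathtt{true}]\!]nPh=\mathsf{true}$; $[\![x]\!]nPh=h.x$; $[\![\mathtt{if}\ e\ \mathtt{then}\ e_1\ \mathtt{else}\ e_2]\!]nPh=$ let $b=[\![e]\!]nPh$ in (if $b$ then $[\![e_1]\!]nPh$ else $[\![e_2]\!]nPh$); $[\![\lambda x.e]\!]nPh=\lambda P'.\lambda d.[\![e]\!]nP'(h[x\mapsto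 d])$; $[\![e_1e_2]\!]nPh=$ let $f=[\![e_1]\!]nPh$ in let $d=[\![e_2]\!]nPh$ in $fPd$; $[\![\mathtt{letrec}\ f(x)=e_1\ \mathtt{in}\ e_2]\!]nPh=[\![e_2]\!]nP(h[f\mapsto\mathit{fix}\,G])$ with $G(g)=\lambda P'.\lambda d.[\![e_1]\!]nP'(h[f\mapsto g,x\mapsto d])$; $[\![\mathtt{signs}\ n'\ e]\!]nPh=[\![e]\!]n'(P\cap\mathcal{A}(n'))h$; $[\![\mathtt{dopriv}\ p\ \mathtt{in}\ e]\!]nPh=[\![e]\!]n(P\sqcup_n\{p\})h$; $[\![\mathtt{check}\ p\ \mathtt{for}\ e]\!]nPh=$ if $p\in P$ then $[\![e]\!]nPh$ else $\star$; $[\![\mathtt{test}\ p\ \mathtt{then}\ e_1\ \mathtt{else}\ e_2]\!]nPh=$ if $p\in P$ then $[\![e_1]\!]nPh$ else $[\![e_2]\!]nPh$. Stacks. $\mathsf{Stacks}$ is the set of nonempty lists of pairs $\langle n,P\rangle\in\mathsf{Principals}\times\mathcal{P}(\mathsf{Privileges})$, ordered by equality; $::$ is cons (head = top). $\mathsf{check}(p,\mathrm{nil})$ is false and $\mathsf{check}(p,\langle n,P\rangle::S)$ iff $p\in\mathcal{A}(n)\wedge(p\in P\vee\mathsf{check}(p,S))$. $\mathsf{privs}(S)=\{p:\mathsf{check}(p,S)\}$. Stack semantics. $[\![\mathtt{bool}]\!]_s=\{\mathsf{true},\mathsf{false}\}$, $[\![t_1\to t_2]\!]_s=\mathsf{Stacks}\to[\![t_1]\!]_s\to[\![t_2]\!]_{s,\bot\star}$;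 $[\![D\vdash e:t]\!]_s\in\mathsf{Stacks}\to[\![D]\!]_s\to[\![t]\!]_{s,\bot\star}$, written $[\![e]\!]_sSh$: $[\![\mathtt{true}]\!]_sSh=\mathsf{true}$; $[\![x]\!]_sSh=h.x$; $\mathtt{if}$: let $b=[\![e]\!]_sSh$ in (if $b$ then $[\![e_1]\!]_sSh$ else $[\![e_2]\!]_sSh$); $[\![\lambda x.e]\!]_sSh=\lambda S'.\lambda d.[\![e]\!]_sS'(h[x\mapsto d])$; $[\![e_1e_2]\!]_sSh=$ let $f=[\![e_1]\!]_sSh$ in let $d=[\![e_2]\!]_sSh$ in $fSd$; $[\![\mathtt{letrec}\ f(x)=e_1\ \mathtt{in}\ e_2]\!]_sSh=[\![e_2]\!]_sS(h[f\mapsto\mathit{fix}\,G])$ with $G(g)=\lambda S'.\lambda d.[\![e_1]\!]_sS'(h[f\mapsto g,x\mapsto d])$; $[\![\mathtt{signs}\ n'\ e]\!]_sSh=[\![e]\!]_s(\langle n',\varnothing\rangle::S)h$; $[\![\mathtt{dopriv}\ p\ \mathtt{in}\ e]\!]_s(\langle n,P\rangle::S)h=[\![e]\!]_s(\langle n,P\cup\{p\}\rangle::S)h$; $[\![\mathtt{check}\ p\ \mathtt{for}\ e]\!]_sSh=$ if $\mathsf{check}(p,S)$ then $[\![e]\!]_sSh$ else $\star$; $[\![\mathtt{test}\ p\ \mathtt{then}\ e_1\ \mathtt{else}\ e_2]\!]_sSh=$ if $\mathsf{check}(p,S)$ then $[\![e_1]\!]_sSh$ else $[\![e_2]\!]_sSh$.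 *)

theory Defs
  imports Main
begin

type_synonym vname = string

datatype ty = TBool | TFun ty ty

text \<open>Expressions (Church style: binders carry their types).
  ELam x t e is lambda x:t. e;  ELetrec f x t1 t2 e1 e2 is letrec f(x:t1):t2 = e1 in e2.\<close>
datatype ('n, 'p) exp =
    ETrue
  | EVar vname
  | EIf "('n,'p) exp" "('n,'p) exp" "('n,'p) exp"
  | ELam vname ty "('n,'p) exp"
  | EApp "('n,'p) exp" "('n,'p) exp"
  | ELetrec vname vname ty ty "('n,'p) exp" "('n,'p) exp"
  | ESigns 'n "('n,'p) exp"
  | EDopriv 'p "('n,'p) exp"
  | ECheck 'p "('n,'p) exp"
  | ETest 'p "('n,'p) exp" "('n,'p) exp"

type_synonym tenv = "vname \<Rightarrow> ty option"

inductive has_type :: "tenv \<Rightarrow> ('n,'p) exp \<Rightarrow> ty \<Rightarrow> bool" where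
  T_True: "has_type D ETrue TBool"
| T_Var: "D x = Some t \<Longrightarrow> has_type D (EVar x) t"
| T_If: "has_type D e TBool \<Longrightarrow> has_type D e1 t \<Longrightarrow> has_type D e2 t \<Longrightarrow> has_type D (EIf e e1 e2) t"
| T_Lam: "has_type (D(x \<mapsto> t1)) e t2 \<Longrightarrow> has_type D (ELam x t1 e) (TFun t1 t2)"
| T_App: "has_type D e1 (TFun t1 t2) \<Longrightarrow> has_type D e2 t1 \<Longrightarrow> has_type D (EApp e1 e2) t2"
| T_Letrec: "has_type (D(f \<mapsto> TFun t1 t2, x \<mapsto> t1)) e1 t2 \<Longrightarrow> has_type (D(f \<mapsto> TFun t1 t2)) e2 t
     \<Longrightarrow> has_type D (ELetrec f x t1 t2 e1 e2) t"
| T_Signs: "has_type D e t \<Longrightarrow> has_type D (ESigns n e) t"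
| T_Dopriv: "has_type D e t \<Longrightarrow> has_type D (EDopriv p e) t"
| T_Check: "has_type D e t \<Longrightarrow> has_type D (ECheck p e) t"
| T_Test: "has_type D e1 t \<Longrightarrow> has_type D e2 t \<Longrightarrow> has_type D (ETest p e1 e2) t"

text \<open>Type computation (used by the semantics to know the type of a lambda body);
  for Church-style terms it agrees with has_type.\<close>
primrec typeof :: "tenv \<Rightarrow> ('n,'p) exp \<Rightarrow> ty option" where
  "typeof D ETrue = Some TBool"
| "typeof D (EVar x) = D x"
| "typeof D (EIf e e1 e2) = (case (typeof D e, typeof D e1, typeof D e2) of
      (Some TBool, Some t1, Some t2) \<Rightarrow> (if t1 = t2 then Some t1 else None) | _ \<Rightarrow> None)"
| "typeof D (ELam x t1 e) = map_option (TFun t1) (typeof (D(x \<mapsto> t1)) e)"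
| "typeof D (EApp e1 e2) = (case (typeof D e1, typeof D e2) of
      (Some (TFun t1 t2), Some t1') \<Rightarrow> (if t1 = t1' then Some t2 else None) | _ \<Rightarrow> None)"
| "typeof D (ELetrec f x t1 t2 e1 e2) =
      (if typeof (D(f \<mapsto> TFun t1 t2, x \<mapsto> t1)) e1 = Some t2 then typeof (D(f \<mapsto> TFun t1 t2)) e2 else None)"
| "typeof D (ESigns n e) = typeof D e"
| "typeof D (EDopriv p e) = typeof D e"
| "typeof D (ECheck p e) = typeof D e"
| "typeof D (ETest p e1 e2) = (case (typeof D e1, typeof D e2) of
      (Some t1, Some t2) \<Rightarrow> (if t1 = t2 then Some t1 else None) | _ \<Rightarrow> None)"

primrec is_signs :: "('n,'p) exp \<Rightarrow> bool" where
  "is_signs ETrue = False"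
| "is_signs (EVar x) = False"
| "is_signs (EIf e e1 e2) = False"
| "is_signs (ELam x t e) = False"
| "is_signs (EApp e1 e2) = False"
| "is_signs (ELetrec f x t1 t2 e1 e2) = False"
| "is_signs (ESigns n e) = True"
| "is_signs (EDopriv p e) = False"
| "is_signs (ECheck p e) = False"
| "is_signs (ETest p e1 e2) = False"

primrec standard :: "('n,'p) exp \<Rightarrow> bool" where
  "standard ETrue = True"
| "standard (EVar x) = True"
| "standard (EIf e e1 e2) = (standard e \<and> standard e1 \<and> standard e2)"
| "standard (ELam x t e) = (is_signs e \<and> standard e)"
| "standard (EApp e1 e2) = (standard e1 \<and> standard e2)"
| "standard (ELetrec f x t1 t2 e1 e2) = (is_signs e1 \<and> standard e1 \<and> standard e2)"
| "standard (ESigns n e) = standard e"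
| "standard (EDopriv p e) = standard e"
| "standard (ECheck p e) = standard e"
| "standard (ETest p e1 e2) = (standard e1 \<and> standard e2)"

datatype 'u res = RBot | RStar | RV 'u

definition lift :: "'u set \<Rightarrow> 'u res set" where
  "lift C = {RBot, RStar} \<union> RV ` C"

definition rle :: "('u \<Rightarrow> 'u \<Rightarrow> bool) \<Rightarrow> 'u res \<Rightarrow> 'u res \<Rightarrow> bool" where
  "rle le r r' \<longleftrightarrow> r = RBot \<or> r = r' \<or> (\<exists>a b. r = RV a \<and> r' = RV b \<and> le a b)"

definition rbind :: "'u res \<Rightarrow> ('u \<Rightarrow> 'u res) \<Rightarrow> 'u res" where
  "rbind r k = (case r of RBot \<Rightarrow> RBot | RStar \<Rightarrow> RStar | RV v \<Rightarrow> k v)"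

definition directed :: "'v set \<Rightarrow> ('v \<Rightarrow> 'v \<Rightarrow> bool) \<Rightarrow> 'v set \<Rightarrow> bool" where
  "directed A le X \<longleftrightarrow> X \<noteq> {} \<and> X \<subseteq> A \<and> (\<forall>x\<in>X. \<forall>y\<in>X. \<exists>z\<in>X. le x z \<and> le y z)"

definition is_lub :: "'v set \<Rightarrow> ('v \<Rightarrow> 'v \<Rightarrow> bool) \<Rightarrow> 'v set \<Rightarrow> 'v \<Rightarrow> bool" where
  "is_lub A le X l \<longleftrightarrow> l \<in> A \<and> (\<forall>x\<in>X. le x l) \<and> (\<forall>y\<in>A. (\<forall>x\<in>X. le x y) \<longrightarrow> le l y)"

definition cont :: "'v set \<Rightarrow> ('v \<Rightarrow> 'v \<Rightarrow> bool) \<Rightarrow> 'w set \<Rightarrow> ('w \<Rightarrow> 'w \<Rightarrow> bool) \<Rightarrow> ('v \<Rightarrow> 'w) \<Rightarrow> bool" where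
  "cont A leA B leB g \<longleftrightarrow> (\<forall>d\<in>A. g d \<in> B) \<and>
     (\<forall>X l. directed A leA X \<and> is_lub A leA X l \<longrightarrow> is_lub B leB (g ` X) (g l))"

type_synonym 'u cpo = "'u set \<times> ('u \<Rightarrow> 'u \<Rightarrow> bool)"

text \<open>The function space  Args -> [A -> B_{bot,star}]  (Args discrete, continuous in the
  second argument); functions are normalised to RBot outside their domain.\<close>
definition funsp :: "'a set \<Rightarrow> 'u cpo \<Rightarrow> 'u cpo \<Rightarrow> ('a \<Rightarrow> 'u \<Rightarrow> 'u res) set" where
  "funsp Args A B = {f. (\<forall>x\<in>Args. cont (fst A) (snd A) (lift (fst B)) (rle (snd B)) (f x)) \<and>
                        (\<forall>x d. x \<notin> Args \<or> d \<notin> fst A \<longrightarrow> f x d = RBot)}"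

definition funle :: "'a set \<Rightarrow> 'u cpo \<Rightarrow> 'u cpo \<Rightarrow> ('a \<Rightarrow> 'u \<Rightarrow> 'u res) \<Rightarrow> ('a \<Rightarrow> 'u \<Rightarrow> 'u res) \<Rightarrow> bool" where
  "funle Args A B f g \<longleftrightarrow> (\<forall>x\<in>Args. \<forall>d\<in>fst A. rle (snd B) (f x d) (g x d))"

text \<open>Semantic values of all types are represented inside one universe type 'u via a chosen
  injection of each (cardinality-bounded) function space.\<close>
definition enc :: "'f set \<Rightarrow> 'f \<Rightarrow> 'u" where
  "enc F = (SOME i. inj_on i F)"

definition dec :: "'f set \<Rightarrow> 'u \<Rightarrow> 'f" where
  "dec F = inv_into F (enc F)"

type_synonym ('n,'p) stack = "('n \<times> 'p set) list"
type_synonym ('n,'p) univ = "('n,'p) stack set"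

definition boolenc :: "bool \<Rightarrow> ('n,'p) univ" where
  "boolenc b = (if b then UNIV else {})"

primrec dom :: "'a set \<Rightarrow> ty \<Rightarrow> ('n,'p) univ cpo" where
  "dom Args TBool = (range boolenc, (=))"
| "dom Args (TFun t1 t2) =
     (let F = funsp Args (dom Args t1) (dom Args t2) in
       (enc F ` F, \<lambda>u v. funle Args (dom Args t1) (dom Args t2) (dec F u) (dec F v)))"

definition fsp :: "'a set \<Rightarrow> ty \<Rightarrow> ty \<Rightarrow> ('a \<Rightarrow> ('n,'p) univ \<Rightarrow> ('n,'p) univ res) set" where
  "fsp Args t1 t2 = funsp Args (dom Args t1) (dom Args t2)"

definition mkfun :: "'a set \<Rightarrow> ty \<Rightarrow> ty \<Rightarrow> ('a \<Rightarrow> ('n,'p) univ \<Rightarrow> ('n,'p) univ res) \<Rightarrow> ('n,'p) univ" where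
  "mkfun Args t1 t2 f =
     enc (fsp Args t1 t2) (\<lambda>x d. if x \<in> Args \<and> d \<in> fst (dom Args t1) then f x d else RBot)"

definition appv :: "'a set \<Rightarrow> ty \<Rightarrow> ty \<Rightarrow> ('n,'p) univ \<Rightarrow> 'a \<Rightarrow> ('n,'p) univ \<Rightarrow> ('n,'p) univ res" where
  "appv Args t1 t2 u x d = dec (fsp Args t1 t2) u x d"

definition fixv :: "'a set \<Rightarrow> ty \<Rightarrow> (('n,'p) univ \<Rightarrow> ('n,'p) univ) \<Rightarrow> ('n,'p) univ" where
  "fixv Args t G = (THE g. g \<in> fst (dom Args t) \<and> G g = g \<and>
                      (\<forall>h\<in>fst (dom Args t). G h = h \<longrightarrow> snd (dom Args t) g h))"

definition emptyenv :: "vname \<Rightarrow> ('n,'p) univ" where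
  "emptyenv = (\<lambda>_. {})"

definition join_priv :: "('n \<Rightarrow> 'p set) \<Rightarrow> 'n \<Rightarrow> 'p set \<Rightarrow> 'p \<Rightarrow> 'p set" where
  "join_priv ACL n P p = (if p \<in> ACL n then insert p P else P)"

abbreviation PrivSets :: "'p set set" where "PrivSets \<equiv> UNIV"

primrec esem :: "('n \<Rightarrow> 'p set) \<Rightarrow> tenv \<Rightarrow> ('n,'p) exp \<Rightarrow> 'n \<Rightarrow> 'p set
                  \<Rightarrow> (vname \<Rightarrow> ('n,'p) univ) \<Rightarrow> ('n,'p) univ res" where
  "esem ACL D ETrue n P h = RV (boolenc True)"
| "esem ACL D (EVar x) n P h = RV (h x)"
| "esem ACL D (EIf e e1 e2) n P h =
     rbind (esem ACL D e n P h) (\<lambda>b. if b = boolenc True then esem ACL D e1 n P h else esem ACL D e2 n P h)"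
| "esem ACL D (ELam x t1 e) n P h =
     (case typeof (D(x \<mapsto> t1)) e of
        Some t2 \<Rightarrow> RV (mkfun PrivSets t1 t2 (\<lambda>P' d. esem ACL (D(x \<mapsto> t1)) e n P' (h(x := d))))
      | None \<Rightarrow> RBot)"
| "esem ACL D (EApp e1 e2) n P h =
     (case typeof D e1 of
        Some (TFun t1 t2) \<Rightarrow>
          rbind (esem ACL D e1 n P h) (\<lambda>f. rbind (esem ACL D e2 n P h) (\<lambda>d. appv PrivSets t1 t2 f P d))
      | _ \<Rightarrow> RBot)"
| "esem ACL D (ELetrec f x t1 t2 e1 e2) n P h =
     esem ACL (D(f \<mapsto> TFun t1 t2)) e2 n P
       (h(f := fixv (PrivSets :: 'p set set) (TFun t1 t2)
                (\<lambda>g. mkfun PrivSets t1 t2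
                       (\<lambda>P' d. esem ACL (D(f \<mapsto> TFun t1 t2, x \<mapsto> t1)) e1 n P' (h(f := g, x := d))))))"
| "esem ACL D (ESigns n' e) n P h = esem ACL D e n' (P \<inter> ACL n') h"
| "esem ACL D (EDopriv p e) n P h = esem ACL D e n (join_priv ACL n P p) h"
| "esem ACL D (ECheck p e) n P h = (if p \<in> P then esem ACL D e n P h else RStar)"
| "esem ACL D (ETest p e1 e2) n P h = (if p \<in> P then esem ACL D e1 n P h else esem ACL D e2 n P h)"

definition Stacks :: "('n,'p) stack set" where
  "Stacks = {S. S \<noteq> []}"

fun check :: "('n \<Rightarrow> 'p set) \<Rightarrow> 'p \<Rightarrow> ('n,'p) stack \<Rightarrow> bool" where
  "check ACL p [] = False"
| "check ACL p ((n, P) # S) = (p \<in> ACL n \<and> (p \<in> P \<or> check ACL p S))"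

definition privs :: "('n \<Rightarrow> 'p set) \<Rightarrow> ('n,'p) stack \<Rightarrow> 'p set" where
  "privs ACL S = {p. check ACL p S}"

primrec ssem :: "('n \<Rightarrow> 'p set) \<Rightarrow> tenv \<Rightarrow> ('n,'p) exp \<Rightarrow> ('n,'p) stack
                  \<Rightarrow> (vname \<Rightarrow> ('n,'p) univ) \<Rightarrow> ('n,'p) univ res" where
  "ssem ACL D ETrue S h = RV (boolenc True)"
| "ssem ACL D (EVar x) S h = RV (h x)"
| "ssem ACL D (EIf e e1 e2) S h =
     rbind (ssem ACL D e S h) (\<lambda>b. if b = boolenc True then ssem ACL D e1 S h else ssem ACL D e2 S h)"
| "ssem ACL D (ELam x t1 e) S h =
     (case typeof (D(x \<mapsto> t1)) e of
        Some t2 \<Rightarrow> RV (mkfun Stacks t1 t2 (\<lambda>S' d. ssem ACL (D(x \<mapsto> t1)) e S' (h(x := d))))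
      | None \<Rightarrow> RBot)"
| "ssem ACL D (EApp e1 e2) S h =
     (case typeof D e1 of
        Some (TFun t1 t2) \<Rightarrow>
          rbind (ssem ACL D e1 S h) (\<lambda>f. rbind (ssem ACL D e2 S h) (\<lambda>d. appv Stacks t1 t2 f S d))
      | _ \<Rightarrow> RBot)"
| "ssem ACL D (ELetrec f x t1 t2 e1 e2) S h =
     ssem ACL (D(f \<mapsto> TFun t1 t2)) e2 S
       (h(f := fixv (Stacks :: ('n,'p) stack set) (TFun t1 t2)
                (\<lambda>g. mkfun Stacks t1 t2
                       (\<lambda>S' d. ssem ACL (D(f \<mapsto> TFun t1 t2, x \<mapsto> t1)) e1 S' (h(f := g, x := d))))))"
| "ssem ACL D (ESigns n' e) S h = ssem ACL D e ((n', {}) # S) h"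
| "ssem ACL D (EDopriv p e) S h =
     (case S of [] \<Rightarrow> RBot | (n, P) # S' \<Rightarrow> ssem ACL D e ((n, insert p P) # S') h)"
| "ssem ACL D (ECheck p e) S h = (if check ACL p S then ssem ACL D e S h else RStar)"
| "ssem ACL D (ETest p e1 e2) S h = (if check ACL p S then ssem ACL D e1 S h else ssem ACL D e2 S h)"

end

theory Submission
  imports Defs "HOL-Library.FuncSet"
begin

text \<open>The two semantics are compared by a type-indexed logical relation: functions are related if, for
  every stack \<open>S\<close>, calling the eager one with \<open>privs S\<close> and the other with \<open>S\<close> on related
  arguments gives related results. In a standard program every function body starts with \<open>signs\<close>, so
  a call depends on its caller's stack only through \<open>privs S\<close>. Recursion is handled by relating the
  Kleene approximants and passing to the limit.

  The representation of all semantic values in a single type of size \<open>2^k\<close>, \<open>k\<close> the number of stacks,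
  has to be justified first. Each domain is the directed limit of finite deflations indexed by finite
  sets of function arguments, so it has a dense subset of size at most \<open>k\<close>; a continuous function
  is determined by its values on that subset, whence there are at most \<open>2^k\<close> of them.\<close>

section \<open>Directed limits\<close>

text \<open>That the universe is large enough is a theorem and not a convention, because
  \<open>enc\<close> picks its injection by Hilbert choice: where none exists, \<open>dec\<close> is
  arbitrary and application no longer undoes abstraction. All functions from \<open>univ\<close> to
  \<open>univ\<close> are too many for \<open>univ\<close>; continuity has to bring the number down.
  The injection at \<open>TFun t1 t2\<close> needs a small dense subset of the domain of
  \<open>t1\<close>, whose order is itself read through such an injection, so order, injectivity and
  approximation are established together by induction on types.

  The invariant of the comparison is that the eager privilege set is \<open>privs\<close> of the
  stack and that the eager principal is that of the top frame. Calls threaten only the second half: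
  an eager closure remembers the principal that created it, while a stack closure runs on the stack
  of its caller. A leading \<open>signs\<close> replaces the remembered principal before it is read.

  \<open>fixv\<close> is a description, and it is continuity that makes it denote. Hence the
  semantics is shown continuous in the environment, with soundness as a by-product, before recursion
  is related.\<close>

definition po :: "'v set \<Rightarrow> ('v \<Rightarrow> 'v \<Rightarrow> bool) \<Rightarrow> bool" where
  "po A le \<longleftrightarrow> (\<forall>x\<in>A. le x x) \<and> (\<forall>x\<in>A. \<forall>y\<in>A. \<forall>z\<in>A. le x y \<longrightarrow> le y z \<longrightarrow> le x z) \<and>
     (\<forall>x\<in>A. \<forall>y\<in>A. le x y \<longrightarrow> le y x \<longrightarrow> x = y)"

text \<open>Without a least element, since truth values are ordered discretely; bottoms come from
  \<open>lift\<close>.\<close>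

definition dcpo :: "'v set \<Rightarrow> ('v \<Rightarrow> 'v \<Rightarrow> bool) \<Rightarrow> bool" where
  "dcpo A le \<longleftrightarrow> po A le \<and> (\<forall>X. directed A le X \<longrightarrow> (\<exists>l. is_lub A le X l))"

definition dir :: "'i set \<Rightarrow> ('i \<Rightarrow> 'i \<Rightarrow> bool) \<Rightarrow> bool" where
  "dir I r \<longleftrightarrow> I \<noteq> {} \<and> (\<forall>i\<in>I. \<forall>j\<in>I. \<exists>k\<in>I. r i k \<and> r j k)"

text \<open>Indexed families instead of sets of values: several families can then share one index
  and be taken to the limit together.\<close>

definition dlim :: "'v set \<Rightarrow> ('v \<Rightarrow> 'v \<Rightarrow> bool) \<Rightarrow> 'i set \<Rightarrow> ('i \<Rightarrow> 'i \<Rightarrow> bool) \<Rightarrow> ('i \<Rightarrow> 'v) \<Rightarrow> 'v \<Rightarrow> bool" where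
  "dlim A le I r f l \<longleftrightarrow> (\<forall>i\<in>I. f i \<in> A) \<and> (\<forall>i\<in>I. \<forall>j\<in>I. r i j \<longrightarrow> le (f i) (f j)) \<and> is_lub A le (f ` I) l"

lemma po_refl: "po A le \<Longrightarrow> x \<in> A \<Longrightarrow> le x x"
  and po_trans: "po A le \<Longrightarrow> le x y \<Longrightarrow> le y z \<Longrightarrow> x \<in> A \<Longrightarrow> y \<in> A \<Longrightarrow> z \<in> A \<Longrightarrow> le x z"
  and po_antisym: "po A le \<Longrightarrow> le x y \<Longrightarrow> le y x \<Longrightarrow> x \<in> A \<Longrightarrow> y \<in> A \<Longrightarrow> x = y"
  unfolding po_def by blast+

lemma dcpo_po: "dcpo A le \<Longrightarrow> po A le"
  by (simp add: dcpo_def)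

lemma is_lub_unique: "po A le \<Longrightarrow> is_lub A le X l \<Longrightarrow> is_lub A le X l' \<Longrightarrow> l = l'"
  unfolding is_lub_def po_def by blast

lemma dlimI:
  assumes "\<And>i. i \<in> I \<Longrightarrow> f i \<in> A" "\<And>i j. i \<in> I \<Longrightarrow> j \<in> I \<Longrightarrow> r i j \<Longrightarrow> le (f i) (f j)" "l \<in> A"
    "\<And>i. i \<in> I \<Longrightarrow> le (f i) l" "\<And>y. y \<in> A \<Longrightarrow> (\<And>i. i \<in> I \<Longrightarrow> le (f i) y) \<Longrightarrow> le l y"
  shows "dlim A le I r f l"
  using assms unfolding dlim_def is_lub_def by auto

lemma dlimD:
  assumes "dlim A le I r f l"
  shows dlim_mem: "i \<in> I \<Longrightarrow> f i \<in> A" and dlim_mono: "i \<in> I \<Longrightarrow> j \<in> I \<Longrightarrow> r i j \<Longrightarrow> le (f i) (f j)"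
    and dlim_in: "l \<in> A" and dlim_le: "i \<in> I \<Longrightarrow> le (f i) l"
    and dlim_least: "y \<in> A \<Longrightarrow> (\<And>i. i \<in> I \<Longrightarrow> le (f i) y) \<Longrightarrow> le l y"
  using assms unfolding dlim_def is_lub_def by auto

lemma dlim_unique: "po A le \<Longrightarrow> dlim A le I r f l \<Longrightarrow> dlim A le I r f l' \<Longrightarrow> l = l'"
  unfolding dlim_def using is_lub_unique by metis

lemma dlim_cong: "(\<And>i. i \<in> I \<Longrightarrow> f i = g i) \<Longrightarrow> dlim A le I r f l = dlim A le I r g l"
  unfolding dlim_def by (auto cong: image_cong)

lemma dlim_const: "po A le \<Longrightarrow> dir I r \<Longrightarrow> a \<in> A \<Longrightarrow> dlim A le I r (\<lambda>_. a) a"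
  by (rule dlimI) (auto simp: po_refl dir_def)

lemma dir_image:
  assumes "dir I r" "\<And>i. i \<in> I \<Longrightarrow> f i \<in> A" "\<And>i j. i \<in> I \<Longrightarrow> j \<in> I \<Longrightarrow> r i j \<Longrightarrow> le (f i) (f j)"
  shows "directed A le (f ` I)"
  unfolding directed_def
proof (intro conjI ballI)
  show "f ` I \<noteq> {}" "f ` I \<subseteq> A" using assms(1,2) by (auto simp: dir_def)
  fix x y assume "x \<in> f ` I" "y \<in> f ` I"
  then obtain i j where ij: "i \<in> I" "j \<in> I" "x = f i" "y = f j" by blast
  then obtain k where "k \<in> I" "r i k" "r j k" using assms(1) unfolding dir_def by blast
  then show "\<exists>z\<in>f ` I. le x z \<and> le y z" using assms(3) ij by blast
qed

lemma directed_dlim: "directed A le X \<Longrightarrow> is_lub A le X l \<Longrightarrow> dlim A le X le (\<lambda>x. x) l"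
  and directed_dir: "directed A le X \<Longrightarrow> dir X le"
  unfolding dlim_def directed_def dir_def by auto

lemma dcpo_dlim:
  assumes "dcpo A le" "dir I r" "\<And>i. i \<in> I \<Longrightarrow> f i \<in> A" "\<And>i j. i \<in> I \<Longrightarrow> j \<in> I \<Longrightarrow> r i j \<Longrightarrow> le (f i) (f j)"
  obtains l where "dlim A le I r f l"
proof -
  have "directed A le (f ` I)" using assms(2-4) by (rule dir_image)
  then obtain l where "is_lub A le (f ` I) l" using assms(1) unfolding dcpo_def by blast
  then show thesis using that assms(3,4) unfolding dlim_def by blast
qed

text \<open>The diagonal is cofinal: an upper bound \<open>k\<close> of \<open>i\<close> and
  \<open>j\<close> puts \<open>F i j\<close> below \<open>F k k\<close>. This is the tool wherever
  two approximations proceed at once.\<close>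

lemma dlim_diag:
  assumes I: "dir I r" and po: "po B le"
    and row: "\<And>i. i \<in> I \<Longrightarrow> dlim B le I r (F i) (G i)" and lim: "dlim B le I r G l"
    and mono: "\<And>i j k. i \<in> I \<Longrightarrow> j \<in> I \<Longrightarrow> k \<in> I \<Longrightarrow> r i j \<Longrightarrow> le (F i k) (F j k)"
  shows "dlim B le I r (\<lambda>i. F i i) l"
proof (rule dlimI)
  have mem: "i \<in> I \<Longrightarrow> j \<in> I \<Longrightarrow> F i j \<in> B" for i j using dlim_mem[OF row] .
  show "F i i \<in> B" if "i \<in> I" for i using mem that by blast
  have m2: "le (F i j) (F k k)" if "i \<in> I" "j \<in> I" "k \<in> I" "r i k" "r j k" for i j k
    using po_trans[OF po mono[of i k j] dlim_mono[OF row, of k j k]] mem that by auto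
  show "le (F i i) (F j j)" if "i \<in> I" "j \<in> I" "r i j" for i j using m2 that by blast
  show "l \<in> B" using dlim_in[OF lim] .
  show "le (F i i) l" if "i \<in> I" for i
    using po_trans[OF po dlim_le[OF row[OF that] that] dlim_le[OF lim that]] mem that
      dlim_in[OF lim] dlim_mem[OF lim] by blast
  fix y assume y: "y \<in> B" "\<And>i. i \<in> I \<Longrightarrow> le (F i i) y"
  show "le l y"
  proof (rule dlim_least[OF lim y(1)])
    fix i assume i: "i \<in> I"
    show "le (G i) y"
    proof (rule dlim_least[OF row[OF i] y(1)])
      fix j assume j: "j \<in> I"
      obtain k where "k \<in> I" "r i k" "r j k" using I i j unfolding dir_def by blast
      then show "le (F i j) y" using po_trans[OF po m2[OF i j] y(2)] i j mem y by blast
    qed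
  qed
qed

lemma contI:
  assumes "\<And>d. d \<in> A \<Longrightarrow> g d \<in> B"
    "\<And>X l. dir X leA \<Longrightarrow> dlim A leA X leA (\<lambda>x. x) l \<Longrightarrow> dlim B leB X leA g (g l)"
  shows "cont A leA B leB g"
  unfolding cont_def
proof (intro conjI allI impI ballI)
  show "g d \<in> B" if "d \<in> A" for d by (rule assms(1)) (rule that)
  fix X l assume "directed A leA X \<and> is_lub A leA X l"
  then have "dlim B leB X leA g (g l)"
    using assms(2)[OF directed_dir directed_dlim] by metis
  then show "is_lub B leB (g ` X) (g l)" by (simp add: dlim_def)
qed

lemma cont_mem: "cont A leA B leB g \<Longrightarrow> d \<in> A \<Longrightarrow> g d \<in> B"
  by (simp add: cont_def)

text \<open>A comparable pair is a directed set whose least upper bound is its larger element, so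
  preservation of directed suprema contains monotonicity.\<close>

lemma cont_mono:
  assumes g: "cont A leA B leB g" and po: "po A leA" and le: "leA x y" "x \<in> A" "y \<in> A"
  shows "leB (g x) (g y)"
proof -
  have "directed A leA {x, y}" "is_lub A leA {x, y} y"
    using le po_refl[OF po] by (auto simp: directed_def is_lub_def)
  then have "is_lub B leB (g ` {x, y}) (g y)" using g unfolding cont_def by blast
  then show ?thesis by (simp add: is_lub_def)
qed

lemma cont_dlim:
  assumes g: "cont A leA B leB g" and po: "po A leA" and I: "dir I r" and lim: "dlim A leA I r f l"
  shows "dlim B leB I r (\<lambda>i. g (f i)) (g l)"
proof -
  have "directed A leA (f ` I)" by (rule dir_image[OF I]) (use dlimD(1,2)[OF lim] in auto)
  then have "is_lub B leB (g ` f ` I) (g l)" using g lim unfolding cont_def dlim_def by blast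
  then show ?thesis using dlimD(1,2)[OF lim] cont_mem[OF g] cont_mono[OF g po]
    by (auto simp: dlim_def image_image)
qed

lemma cont_const: "po B leB \<Longrightarrow> b \<in> B \<Longrightarrow> cont A leA B leB (\<lambda>_. b)"
  by (rule contI) (auto intro: dlim_const)

lemma cont_comp:
  assumes "cont A leA B leB f" "cont B leB C leC g" "po A leA" "po B leB"
  shows "cont A leA C leC (\<lambda>x. g (f x))"
proof (rule contI)
  show "g (f d) \<in> C" if "d \<in> A" for d using cont_mem assms(1,2) that by metis
  show "dlim C leC X leA (\<lambda>x. g (f x)) (g (f l))" if "dir X leA" "dlim A leA X leA (\<lambda>x. x) l" for X l
    using cont_dlim[OF assms(2,4) that(1) cont_dlim[OF assms(1,3) that]] .
qed

lemma cont_cong: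
  assumes "cont A leA B leB f" "\<And>x. x \<in> A \<Longrightarrow> f x = g x"
  shows "cont A leA B leB g"
  unfolding cont_def
proof (intro conjI ballI allI impI)
  show "g d \<in> B" if "d \<in> A" for d using cont_mem[OF assms(1) that] assms(2)[OF that] by simp
  fix X l assume X: "directed A leA X \<and> is_lub A leA X l"
  then have "f ` X = g ` X" "f l = g l"
    using assms(2) unfolding directed_def is_lub_def by (auto intro!: image_cong)
  then show "is_lub B leB (g ` X) (g l)" using assms(1) X unfolding cont_def by metis
qed

section \<open>Adjoining divergence and error\<close>

lemma rle_simps [simp]: "rle le RBot r" "rle le r RBot \<longleftrightarrow> r = RBot" "rle le RStar r \<longleftrightarrow> r = RStar"
  "rle le r RStar \<longleftrightarrow> r = RBot \<or> r = RStar" "rle le (RV a) (RV b) \<longleftrightarrow> a = b \<or> le a b"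
  by (auto simp: rle_def)

lemma RV_rleE:
  assumes "rle le (RV a) r"
  obtains b where "r = RV b" "a = b \<or> le a b"
  using assms by (cases r) auto

lemma lift_simps [simp]: "RBot \<in> lift A" "RStar \<in> lift A" "RV a \<in> lift A \<longleftrightarrow> a \<in> A"
  by (auto simp: lift_def)

lemma rbind_simps [simp]: "rbind RBot k = RBot" "rbind RStar k = RStar" "rbind (RV v) k = k v"
  by (simp_all add: rbind_def)

lemma po_lift:
  assumes "po A le"
  shows "po (lift A) (rle le)"
  unfolding po_def
proof (intro conjI ballI impI)
  show "rle le x z" if "x \<in> lift A" "y \<in> lift A" "z \<in> lift A" "rle le x y" "rle le y z" for x y z
    using that by (cases x; cases y; cases z) (auto intro: po_trans[OF assms])
  show "x = y" if "x \<in> lift A" "y \<in> lift A" "rle le x y" "rle le y x" for x y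
    using that by (cases x; cases y) (auto intro: po_antisym[OF assms])
qed (simp add: rle_def)

text \<open>Errors and values are incomparable, with only \<open>RBot\<close> below both, so a
  monotone family that has left \<open>RBot\<close> stays at the error or stays among values. In the
  latter case the indices still at \<open>RBot\<close> are dropped; the remaining ones are closed
  under \<open>r\<close> and hence directed.\<close>

lemma dlim_lift_cases:
  assumes I: "dir I r" and po: "po A le" and lim: "dlim (lift A) (rle le) I r m l"
  shows "(l = RBot \<and> (\<forall>i\<in>I. m i = RBot)) \<or> (l = RStar \<and> (\<exists>i\<in>I. m i = RStar)) \<or>
    (\<exists>a d. l = RV a \<and> dir {i \<in> I. m i \<noteq> RBot} r \<and> dlim A le {i \<in> I. m i \<noteq> RBot} r d a \<and>
      (\<forall>i\<in>I. m i \<noteq> RBot \<longrightarrow> m i = RV (d i)))"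
proof (cases "\<forall>i\<in>I. m i = RBot")
  case True
  have "rle le l RBot" by (rule dlim_least[OF lim]) (simp_all add: True)
  then show ?thesis using True by simp
next
  case False
  then obtain i0 where i0: "i0 \<in> I" "m i0 \<noteq> RBot" by blast
  have mono: "rle le (m i) (m j)" if "i \<in> I" "j \<in> I" "r i j" for i j
    using dlim_mono[OF lim that] .
  have l: "rle le (m i) l" if "i \<in> I" for i using dlim_le[OF lim that] .
  show ?thesis
  proof (cases "\<exists>i\<in>I. m i = RStar")
    case True
    then obtain i where i: "i \<in> I" "m i = RStar" by blast
    then have "l = RStar" using l[OF i(1)] by simp
    then show ?thesis using True by simp
  next
    case no_star: False
    let ?J = "{i \<in> I. m i \<noteq> RBot}"
    have v: "\<exists>d. m i = RV d" if "i \<in> ?J" for i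
      using no_star that by (cases "m i") auto
    then have "\<exists>d. \<forall>i\<in>?J. m i = RV (d i)" by metis
    then obtain d where d: "\<And>i. i \<in> ?J \<Longrightarrow> m i = RV (d i)" by blast
    have dA: "d i \<in> A" if "i \<in> ?J" for i
      using dlim_mem[OF lim, of i] d[OF that] that by simp
    obtain a where a: "l = RV a"
      using l[OF i0(1)] d[of i0] i0 RV_rleE by (metis (mono_tags, lifting) mem_Collect_eq)
    have aA: "a \<in> A" using dlim_in[OF lim] a by simp
    have up: "j \<in> ?J" if "i \<in> ?J" "j \<in> I" "r i j" for i j
      using mono[of i j] d[OF that(1)] that by (cases "m j") auto
    have J: "dir ?J r"
      unfolding dir_def
    proof (intro conjI ballI)
      show "?J \<noteq> {}" using i0 by blast
      fix i j assume ij: "i \<in> ?J" "j \<in> ?J"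
      then obtain k where "k \<in> I" "r i k" "r j k" using I unfolding dir_def by blast
      then show "\<exists>k\<in>?J. r i k \<and> r j k" using up[OF ij(1)] by blast
    qed
    have RV_le: "le x y" if "rle le (RV x) (RV y)" "y \<in> A" for x y
      using that(1) po_refl[OF po that(2)] by auto
    have "dlim A le ?J r d a"
    proof (rule dlimI)
      show "le (d i) (d j)" if "i \<in> ?J" "j \<in> ?J" "r i j" for i j
        using mono[of i j] d[OF that(1)] d[OF that(2)] that dA[OF that(2)] RV_le by simp
      show "le (d i) a" if "i \<in> ?J" for i
        using l[of i] d[OF that] that a aA RV_le by simp
      fix y assume y: "y \<in> A" "\<And>i. i \<in> ?J \<Longrightarrow> le (d i) y"
      have "rle le l (RV y)"
      proof (rule dlim_least[OF lim])
        show "rle le (m i) (RV y)" if "i \<in> I" for i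
          using y(2)[of i] d[of i] that by (cases "m i = RBot") simp_all
      qed (simp add: y)
      then show "le a y" using a y(1) RV_le by simp
    qed (fact dA aA)+
    then show ?thesis using a J d by blast
  qed
qed

lemma dlim_RV:
  assumes I: "dir I r" and po: "po A le" and lim: "dlim A le I r d a"
  shows "dlim (lift A) (rle le) I r (\<lambda>i. RV (d i)) (RV a)"
proof (rule dlimI)
  fix y assume y: "y \<in> lift A" "\<And>i. i \<in> I \<Longrightarrow> rle le (RV (d i)) y"
  obtain i where "i \<in> I" using I by (auto simp: dir_def)
  then obtain b where b: "y = RV b" using RV_rleE y(2) by metis
  then have "le (d i) b" if "i \<in> I" for i
    using y that po_refl[OF po, of b] by auto
  then show "rle le (RV a) y" using dlim_least[OF lim, of b] y b by auto
qed (use dlimD[OF lim] in auto)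

text \<open>\<open>RBot\<close> and \<open>RStar\<close> pass through unchanged, so after
  \<open>dlim_lift_cases\<close> only a limit of values calls for the continuity of
  \<open>k\<close>.\<close>

lemma cont_rbind:
  assumes k: "cont A leA (lift B) (rle leB) k" and A: "po A leA" and B: "po B leB"
  shows "cont (lift A) (rle leA) (lift B) (rle leB) (\<lambda>r. rbind r k)"
proof (rule contI)
  have mem: "rbind m k \<in> lift B" if "m \<in> lift A" for m
    using that cont_mem[OF k] by (cases m) auto
  have mono: "rle leB (rbind m k) (rbind m' k)"
    if le: "rle leA m m'" and m: "m \<in> lift A" "m' \<in> lift A" for m m'
  proof (cases m)
    case (RV a)
    then obtain b where b: "m' = RV b" "a = b \<or> leA a b" using le RV_rleE by metis
    moreover have "leA a a" using po_refl[OF A] RV m by simp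
    ultimately show ?thesis using RV m cont_mono[OF k A, of a b] by auto
  qed (use le in auto)
  show "rbind m k \<in> lift B" if "m \<in> lift A" for m using mem that .
  fix X l assume X: "dir X (rle leA)" and lim: "dlim (lift A) (rle leA) X (rle leA) (\<lambda>x. x) l"
  note XA = dlim_mem[OF lim] and lA = dlim_in[OF lim] and Xl = dlim_le[OF lim]
  show "dlim (lift B) (rle leB) X (rle leA) (\<lambda>r. rbind r k) (rbind l k)"
  proof (rule dlimI)
    show "rle leB (rbind m k) (rbind l k)" if "m \<in> X" for m
      by (rule mono[OF Xl[OF that] XA[OF that] lA])
    fix y assume y: "y \<in> lift B" "\<And>m. m \<in> X \<Longrightarrow> rle leB (rbind m k) y"
    show "rle leB (rbind l k) y"
      using dlim_lift_cases[OF X A lim]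
    proof (elim disjE exE conjE)
      fix a d
      let ?J = "{i \<in> X. i \<noteq> RBot}"
      assume l: "l = RV a" and J: "dir ?J (rle leA)" and d: "dlim A leA ?J (rle leA) d a"
        and v: "\<forall>i\<in>X. i \<noteq> RBot \<longrightarrow> i = RV (d i)"
      have "rle leB (k (d i)) y" if "i \<in> ?J" for i
        using y(2)[of i] v that by (metis (mono_tags, lifting) mem_Collect_eq rbind_simps(3))
      then show ?thesis
        using dlim_least[OF cont_dlim[OF k A J d] y(1)] l by simp
    next
      assume "l = RStar" "\<exists>i\<in>X. i = RStar"
      then show ?thesis using y(2)[of RStar] by simp
    qed simp
  qed (use mem mono XA lA in auto)
qed

lemma dcpo_lift:
  assumes A: "dcpo A le"
  shows "dcpo (lift A) (rle le)"
  unfolding dcpo_def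
proof (intro conjI allI impI)
  note po = dcpo_po[OF A]
  show "po (lift A) (rle le)" using po_lift[OF po] .
  fix X assume X: "directed (lift A) (rle le) X"
  then have XA: "X \<subseteq> lift A" and dX: "\<And>x y. x \<in> X \<Longrightarrow> y \<in> X \<Longrightarrow> \<exists>z\<in>X. rle le x z \<and> rle le y z"
    unfolding directed_def by blast+
  show "\<exists>l. is_lub (lift A) (rle le) X l"
  proof (cases "RStar \<in> X")
    case True
    have "rle le x RStar" if "x \<in> X" for x using dX[OF that True] by auto
    then have "is_lub (lift A) (rle le) X RStar"
      using True unfolding is_lub_def by (metis lift_simps(2))
    then show ?thesis ..
  next
    case no_star: False
    let ?J = "{a. RV a \<in> X}"
    show ?thesis
    proof (cases "?J = {}")
      case True
      have "x = RBot" if "x \<in> X" for x using that True no_star by (cases x) auto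
      then have "is_lub (lift A) (rle le) X RBot" by (simp add: is_lub_def)
      then show ?thesis ..
    next
      case False
      have "directed A le ?J"
        unfolding directed_def
      proof (intro conjI ballI)
        show J: "?J \<subseteq> A" using XA by auto
        fix a b assume ab: "a \<in> ?J" "b \<in> ?J"
        then obtain z where z: "z \<in> X" "rle le (RV a) z" "rle le (RV b) z" using dX by blast
        then obtain c where c: "z = RV c" using RV_rleE by metis
        then have "le c c" using z J po_refl[OF po] by auto
        then show "\<exists>c\<in>?J. le a c \<and> le b c" using z c by auto
      qed (fact False)
      then obtain l where l: "is_lub A le ?J l" using A unfolding dcpo_def by blast
      have "is_lub (lift A) (rle le) X (RV l)"
        unfolding is_lub_def
      proof (intro conjI ballI impI)
        show "RV l \<in> lift A" using l by (simp add: is_lub_def)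
        show "rle le x (RV l)" if "x \<in> X" for x
          using l that no_star by (cases x) (auto simp: is_lub_def)
        fix y assume y: "y \<in> lift A" "\<forall>x\<in>X. rle le x y"
        obtain a0 where "RV a0 \<in> X" using False by blast
        then obtain b where b: "y = RV b" using y(2) RV_rleE by metis
        then have "le a b" if "a \<in> ?J" for a
          using y po_refl[OF po, of b] that by force
        then show "rle le (RV l) y" using l b y(1) by (simp add: is_lub_def)
      qed
      then show ?thesis ..
    qed
  qed
qed

section \<open>Continuous function spaces\<close>

lemma funspI:
  assumes "\<And>x. x \<in> Args \<Longrightarrow> cont (fst A) (snd A) (lift (fst B)) (rle (snd B)) (f x)"
    "\<And>x d. x \<notin> Args \<or> d \<notin> fst A \<Longrightarrow> f x d = RBot"
  shows "f \<in> funsp Args A B"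
  using assms by (simp add: funsp_def)

lemma funspD:
  assumes "f \<in> funsp Args A B"
  shows funsp_cont: "x \<in> Args \<Longrightarrow> cont (fst A) (snd A) (lift (fst B)) (rle (snd B)) (f x)"
    and funsp_out: "x \<notin> Args \<or> d \<notin> fst A \<Longrightarrow> f x d = RBot"
  using assms unfolding funsp_def by blast+

lemma funsp_mem: "f \<in> funsp Args A B \<Longrightarrow> x \<in> Args \<Longrightarrow> d \<in> fst A \<Longrightarrow> f x d \<in> lift (fst B)"
  using cont_mem[OF funsp_cont] .

lemma po_funsp:
  assumes "po (fst B) (snd B)"
  shows "po (funsp Args A B) (funle Args A B)"
  unfolding po_def
proof (intro conjI ballI impI)
  note B = po_lift[OF assms]
  show "funle Args A B f f" if "f \<in> funsp Args A B" for f
    unfolding funle_def using po_refl[OF B] funsp_mem[OF that] by blast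
  show "funle Args A B f h" if "f \<in> funsp Args A B" "g \<in> funsp Args A B" "h \<in> funsp Args A B"
    "funle Args A B f g" "funle Args A B g h" for f g h
    unfolding funle_def
  proof (intro ballI)
    fix x d assume xd: "x \<in> Args" "d \<in> fst A"
    show "rle (snd B) (f x d) (h x d)"
      by (rule po_trans[OF B, of _ "g x d"])
        (use that xd in \<open>auto simp: funle_def intro: funsp_mem\<close>)
  qed
  show "f = g" if "f \<in> funsp Args A B" "g \<in> funsp Args A B"
    "funle Args A B f g" "funle Args A B g f" for f g
  proof (intro ext)
    fix x d
    show "f x d = g x d"
    proof (cases "x \<in> Args \<and> d \<in> fst A")
      case True
      then show ?thesis
        using po_antisym[OF B, of "f x d" "g x d"] funsp_mem[OF that(1)] funsp_mem[OF that(2)] that(3,4)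
        unfolding funle_def by blast
    next
      case False
      then show ?thesis using funsp_out[OF that(1), of x d] funsp_out[OF that(2), of x d] by auto
    qed
  qed
qed

lemma dlim_funspI:
  assumes "\<And>i. i \<in> I \<Longrightarrow> fs i \<in> funsp Args A B" "l \<in> funsp Args A B"
    and lim: "\<And>x d. x \<in> Args \<Longrightarrow> d \<in> fst A \<Longrightarrow>
      dlim (lift (fst B)) (rle (snd B)) I r (\<lambda>i. fs i x d) (l x d)"
  shows "dlim (funsp Args A B) (funle Args A B) I r fs l"
proof (rule dlimI)
  show "funle Args A B (fs i) (fs j)" if "i \<in> I" "j \<in> I" "r i j" for i j
    unfolding funle_def using dlim_mono[OF lim] that by blast
  show "funle Args A B (fs i) l" if "i \<in> I" for i
    unfolding funle_def using dlim_le[OF lim] that by blast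
  fix y assume y: "y \<in> funsp Args A B" "\<And>i. i \<in> I \<Longrightarrow> funle Args A B (fs i) y"
  show "funle Args A B l y" unfolding funle_def
  proof (intro ballI)
    fix x d assume xd: "x \<in> Args" "d \<in> fst A"
    show "rle (snd B) (l x d) (y x d)"
      by (rule dlim_least[OF lim[OF xd] funsp_mem[OF y(1) xd]])
        (use y(2) xd in \<open>auto simp: funle_def\<close>)
  qed
qed (fact assms)+

text \<open>The pointwise limit is continuous because suprema commute: each \<open>fs i\<close>
  reaches its value at \<open>a\<close> through its values on \<open>X\<close>, and these lie below
  those of the limit.\<close>

lemma funsp_pointwise:
  assumes A: "po (fst A) (snd A)" and B: "dcpo (fst B) (snd B)" and I: "dir I r"
    and fs: "\<And>i. i \<in> I \<Longrightarrow> fs i \<in> funsp Args A B"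
    and mono: "\<And>i j. i \<in> I \<Longrightarrow> j \<in> I \<Longrightarrow> r i j \<Longrightarrow> funle Args A B (fs i) (fs j)"
  obtains l where "l \<in> funsp Args A B"
    "\<And>x d. x \<in> Args \<Longrightarrow> d \<in> fst A \<Longrightarrow>
      dlim (lift (fst B)) (rle (snd B)) I r (\<lambda>i. fs i x d) (l x d)"
proof -
  let ?L = "dlim (lift (fst B)) (rle (snd B))"
  note poB = po_lift[OF dcpo_po[OF B]]
  have "\<exists>l. ?L I r (\<lambda>i. fs i x d) l" if "x \<in> Args" "d \<in> fst A" for x d
    using dcpo_dlim[OF dcpo_lift[OF B] I, of "\<lambda>i. fs i x d"] mono funsp_mem[OF fs] that
    unfolding funle_def by metis
  then obtain l0 where l0: "\<And>x d. x \<in> Args \<Longrightarrow> d \<in> fst A \<Longrightarrow> ?L I r (\<lambda>i. fs i x d) (l0 x d)"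
    by metis
  \<comment> \<open>\<open>RBot\<close> off the domain is the normal form that \<open>funsp\<close>
    prescribes.\<close>
  define l where "l = (\<lambda>x d. if x \<in> Args \<and> d \<in> fst A then l0 x d else RBot)"
  have l: "?L I r (\<lambda>i. fs i x d) (l x d)" if "x \<in> Args" "d \<in> fst A" for x d
    using l0 that by (simp add: l_def)
  have "l \<in> funsp Args A B"
  proof (rule funspI)
    fix x assume x: "x \<in> Args"
    have le_l: "rle (snd B) (fs i x d) y"
      if "i \<in> I" "d \<in> fst A" "rle (snd B) (l x d) y" "y \<in> lift (fst B)" for i d y
      using po_trans[OF poB dlim_le[OF l[OF x]]] that funsp_mem[OF fs x] dlim_in[OF l[OF x]] by blast
    have mono_l: "rle (snd B) (l x d) (l x d')"
      if dd: "d \<in> fst A" "d' \<in> fst A" "snd A d d'" for d d'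
    proof (rule dlim_least[OF l[OF x dd(1)] dlim_in[OF l[OF x dd(2)]]])
      fix i assume i: "i \<in> I"
      have "rle (snd B) (fs i x d) (fs i x d')"
        using cont_mono[OF funsp_cont[OF fs[OF i] x] A] dd by blast
      then show "rle (snd B) (fs i x d) (l x d')"
        using po_trans[OF poB _ dlim_le[OF l[OF x dd(2)] i]] funsp_mem[OF fs[OF i] x] dd
          dlim_in[OF l[OF x dd(2)]] by blast
    qed
    show "cont (fst A) (snd A) (lift (fst B)) (rle (snd B)) (l x)"
    proof (rule contI)
      show "l x d \<in> lift (fst B)" if "d \<in> fst A" for d using dlim_in[OF l[OF x that]] .
      fix X a assume X: "dir X (snd A)" and lim: "dlim (fst A) (snd A) X (snd A) (\<lambda>x. x) a"
      note XA = dlim_mem[OF lim] and aA = dlim_in[OF lim]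
      show "?L X (snd A) (l x) (l x a)"
      proof (rule dlimI)
        fix y assume y: "y \<in> lift (fst B)" "\<And>d. d \<in> X \<Longrightarrow> rle (snd B) (l x d) y"
        show "rle (snd B) (l x a) y"
        proof (rule dlim_least[OF l[OF x aA] y(1)])
          fix i assume i: "i \<in> I"
          show "rle (snd B) (fs i x a) y"
            using dlim_least[OF cont_dlim[OF funsp_cont[OF fs[OF i] x] A X lim] y(1)]
              le_l[OF i XA y(2) y(1)] by blast
        qed
      qed (use XA aA dlim_in[OF l[OF x]] mono_l dlim_le[OF lim] in blast)+
    qed
  qed (auto simp: l_def)
  then show thesis using that l by blast
qed

lemma dcpo_funsp:
  assumes A: "po (fst A) (snd A)" and B: "dcpo (fst B) (snd B)"
  shows "dcpo (funsp Args A B) (funle Args A B)"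
  unfolding dcpo_def
proof (intro conjI allI impI)
  show "po (funsp Args A B) (funle Args A B)" using po_funsp[OF dcpo_po[OF B]] .
  fix X assume X: "directed (funsp Args A B) (funle Args A B) X"
  obtain l where "l \<in> funsp Args A B" "\<And>x d. x \<in> Args \<Longrightarrow> d \<in> fst A \<Longrightarrow>
      dlim (lift (fst B)) (rle (snd B)) X (funle Args A B) (\<lambda>f. f x d) (l x d)"
    using funsp_pointwise[OF A B directed_dir[OF X], of "\<lambda>f. f" Args] X
    unfolding directed_def by blast
  then have "dlim (funsp Args A B) (funle Args A B) X (funle Args A B) (\<lambda>f. f) l"
    using X by (intro dlim_funspI) (auto simp: directed_def)
  then show "\<exists>l. is_lub (funsp Args A B) (funle Args A B) X l"
    unfolding dlim_def by auto
qed

text \<open>A pointwise limit exists and is a limit in the function space, so by uniqueness every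
  limit there is the pointwise one.\<close>

lemma dlim_funspD:
  assumes A: "po (fst A) (snd A)" and B: "dcpo (fst B) (snd B)" and I: "dir I r"
    and lim: "dlim (funsp Args A B) (funle Args A B) I r fs f" and xd: "x \<in> Args" "d \<in> fst A"
  shows "dlim (lift (fst B)) (rle (snd B)) I r (\<lambda>i. fs i x d) (f x d)"
proof -
  obtain l where l: "l \<in> funsp Args A B"
    "\<And>x d. x \<in> Args \<Longrightarrow> d \<in> fst A \<Longrightarrow>
      dlim (lift (fst B)) (rle (snd B)) I r (\<lambda>i. fs i x d) (l x d)"
    using funsp_pointwise[OF A B I, of fs Args] dlim_mem[OF lim] dlim_mono[OF lim] by blast
  have "dlim (funsp Args A B) (funle Args A B) I r fs l"
    using dlim_funspI[OF dlim_mem[OF lim] l] .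
  then have "f = l" using dlim_unique[OF po_funsp[OF dcpo_po[OF B]] lim] by blast
  then show ?thesis using l(2) xd by blast
qed

section \<open>Transport along an injection\<close>

text \<open>Codes are ordered by pulling back along \<open>d\<close>, which makes \<open>e\<close>
  an isomorphism onto its image. The assumption \<open>d_e\<close> is exactly what would fail in a
  universe that is too small.\<close>

locale order_embedding =
  fixes F :: "'f set" and le :: "'f \<Rightarrow> 'f \<Rightarrow> bool" and e :: "'f \<Rightarrow> 'u" and d :: "'u \<Rightarrow> 'f"
  assumes d_e: "\<And>f. f \<in> F \<Longrightarrow> d (e f) = f"
begin

abbreviation "A \<equiv> e ` F"
abbreviation "leA \<equiv> \<lambda>u v. le (d u) (d v)"

lemma d_mem: "u \<in> A \<Longrightarrow> d u \<in> F" and e_d: "u \<in> A \<Longrightarrow> e (d u) = u"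
  using d_e by auto

lemma po:
  assumes "po F le"
  shows "po A leA"
  unfolding po_def
proof (intro conjI ballI impI)
  show "leA u u" if "u \<in> A" for u using po_refl[OF assms d_mem[OF that]] .
  show "leA u w" if "u \<in> A" "v \<in> A" "w \<in> A" "leA u v" "leA v w" for u v w
    using po_trans[OF assms that(4,5)] d_mem that(1-3) by blast
  show "u = v" if "u \<in> A" "v \<in> A" "leA u v" "leA v u" for u v
    using po_antisym[OF assms that(3,4)] d_mem[OF that(1)] d_mem[OF that(2)] e_d that(1,2) by metis
qed

lemma is_lub_iff: "Y \<subseteq> A \<Longrightarrow> l \<in> A \<Longrightarrow> is_lub A leA Y l \<longleftrightarrow> is_lub F le (d ` Y) (d l)"
  unfolding is_lub_def by (auto simp: d_e)

lemma dlim_iff: "dlim A leA I r us u \<longleftrightarrow> (\<forall>i\<in>I. us i \<in> A) \<and> u \<in> A \<and> dlim F le I r (\<lambda>i. d (us i)) (d u)"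
proof (cases "(\<forall>i\<in>I. us i \<in> A) \<and> u \<in> A")
  case True
  then have "us ` I \<subseteq> A" by blast
  then show ?thesis using True is_lub_iff[of "us ` I" u] d_mem
    unfolding dlim_def image_image by auto
qed (auto simp: dlim_def is_lub_def)

lemma dcpo:
  assumes "dcpo F le"
  shows "dcpo A leA"
  unfolding dcpo_def
proof (intro conjI allI impI)
  show "po A leA" using po dcpo_po[OF assms] .
  fix Y assume Y: "directed A leA Y"
  then have YA: "Y \<subseteq> A" unfolding directed_def by blast
  have "directed F le (d ` Y)"
    using Y d_mem unfolding directed_def by blast
  then obtain l where l: "is_lub F le (d ` Y) l" using assms unfolding dcpo_def by blast
  then have "l \<in> F" unfolding is_lub_def by blast
  then have "is_lub A leA Y (e l)" using is_lub_iff[OF YA, of "e l"] l d_e by simp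
  then show "\<exists>l. is_lub A leA Y l" ..
qed

end

section \<open>Approximation by finite deflations\<close>

abbreviation Fin :: "'a set set" where "Fin \<equiv> {s. finite s}"

lemma dir_Fin: "dir Fin (\<subseteq>)"
proof -
  have "\<exists>k\<in>Fin. i \<subseteq> k \<and> j \<subseteq> k" if "i \<in> Fin" "j \<in> Fin" for i j :: "'a set"
    using that by (intro bexI[of _ "i \<union> j"]) auto
  then show ?thesis unfolding dir_def by blast
qed

text \<open>That the maps grow with \<open>s\<close> and lie below the identity is contained in
  \<open>dlim\<close>. Indexing by finite sets of arguments is the same at every type, so
  approximations of argument and result can run in step.\<close>

definition deflations :: "'v set \<Rightarrow> ('v \<Rightarrow> 'v \<Rightarrow> bool) \<Rightarrow> ('a set \<Rightarrow> 'v \<Rightarrow> 'v) \<Rightarrow> bool" where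
  "deflations A le \<pi> \<longleftrightarrow> (\<forall>s\<in>Fin. cont A le A le (\<pi> s) \<and> finite (\<pi> s ` A)) \<and>
     (\<forall>a\<in>A. dlim A le Fin (\<subseteq>) (\<lambda>s. \<pi> s a) a)"

lemma deflationsD:
  assumes "deflations A le \<pi>"
  shows deflations_cont: "finite s \<Longrightarrow> cont A le A le (\<pi> s)"
    and deflations_finite: "finite s \<Longrightarrow> finite (\<pi> s ` A)"
    and deflations_dlim: "a \<in> A \<Longrightarrow> dlim A le Fin (\<subseteq>) (\<lambda>s. \<pi> s a) a"
  using assms unfolding deflations_def by simp_all

lemma cont_RV:
  assumes "po B leB" "cont A leA B leB g"
  shows "cont A leA (lift B) (rle leB) (\<lambda>a. RV (g a))"
proof -
  have "is_lub (lift B) (rle leB) (g' ` X) (g' l)"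
    if X: "directed A leA X" "is_lub A leA X l" and g': "g' = (\<lambda>a. RV (g a))" for X l g'
  proof -
    have l: "is_lub B leB (g ` X) (g l)" using assms(2) X unfolding cont_def by blast
    obtain x where x: "x \<in> X" using X(1) unfolding directed_def by blast
    show ?thesis unfolding is_lub_def g'
    proof (intro conjI ballI impI)
      show "RV (g l) \<in> lift B" using l by (simp add: is_lub_def)
      show "rle leB z (RV (g l))" if "z \<in> (\<lambda>a. RV (g a)) ` X" for z
        using that l by (auto simp: is_lub_def)
      fix y assume y: "y \<in> lift B" "\<forall>x\<in>(\<lambda>a. RV (g a)) ` X. rle leB x y"
      then obtain b where b: "y = RV b" using x RV_rleE by (metis image_eqI)
      then have "leB (g z) b" if "z \<in> X" for z
        using y po_refl[OF assms(1), of b] that by force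
      then show "rle leB (RV (g l)) y" using l b y(1) by (simp add: is_lub_def)
    qed
  qed
  then show ?thesis using cont_mem[OF assms(2)] unfolding cont_def[of _ _ "lift B"] by simp
qed

lemma deflations_lift:
  assumes B: "po B leB" and \<pi>: "deflations B leB \<pi>"
  shows "deflations (lift B) (rle leB) (\<lambda>s m. rbind m (\<lambda>b. RV (\<pi> s b)))"
  unfolding deflations_def
proof (intro conjI ballI)
  fix s :: "'b set" assume "s \<in> Fin"
  then have s: "finite s" by simp
  show "cont (lift B) (rle leB) (lift B) (rle leB) (\<lambda>m. rbind m (\<lambda>b. RV (\<pi> s b)))"
    using cont_rbind[OF cont_RV[OF B deflations_cont[OF \<pi> s]] B B] .
  have "rbind m (\<lambda>b. RV (\<pi> s b)) \<in> {RBot, RStar} \<union> RV ` \<pi> s ` B" if "m \<in> lift B" for m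
    using that by (cases m) simp_all
  then have "(\<lambda>m. rbind m (\<lambda>b. RV (\<pi> s b))) ` lift B \<subseteq> {RBot, RStar} \<union> RV ` \<pi> s ` B"
    by (rule image_subsetI)
  moreover have "finite ({RBot, RStar} \<union> RV ` \<pi> s ` B)"
    using deflations_finite[OF \<pi> s] by simp
  ultimately show "finite ((\<lambda>m. rbind m (\<lambda>b. RV (\<pi> s b))) ` lift B)"
    by (rule finite_subset)
next
  fix m assume m: "m \<in> lift B"
  show "dlim (lift B) (rle leB) Fin (\<subseteq>) (\<lambda>s. rbind m (\<lambda>b. RV (\<pi> s b))) m"
  proof (cases m)
    case (RV b)
    then show ?thesis using dlim_RV[OF dir_Fin B deflations_dlim[OF \<pi>]] m by simp
  qed (use dlim_const[OF po_lift[OF B] dir_Fin m] in auto)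
qed

text \<open>Restricting the argument \<open>x\<close> to a finite set keeps the image of the induced deflation finite,
  although \<open>Args\<close> is infinite in general.\<close>
lemma deflations_funsp:
  fixes \<pi> :: "'a set \<Rightarrow> 'u \<Rightarrow> 'u" and \<rho> :: "'a set \<Rightarrow> 'u res \<Rightarrow> 'u res" and A B :: "'u cpo" and Args
  defines "\<phi> \<equiv> \<lambda>s f x d. if x \<in> s \<and> x \<in> Args \<and> d \<in> fst A then \<rho> s (f x (\<pi> s d)) else RBot"
  assumes A: "po (fst A) (snd A)" and B: "dcpo (fst B) (snd B)"
    and \<pi>: "deflations (fst A) (snd A) \<pi>"
    and \<rho>: "deflations (lift (fst B)) (rle (snd B)) \<rho>"
  shows "deflations (funsp Args A B) (funle Args A B) \<phi>"
proof -
  note BL = po_lift[OF dcpo_po[OF B]]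
  have in_F: "\<phi> s f \<in> funsp Args A B" if s: "finite s" and f: "f \<in> funsp Args A B" for s f
  proof (rule funspI)
    fix x assume x: "x \<in> Args"
    show "cont (fst A) (snd A) (lift (fst B)) (rle (snd B)) (\<phi> s f x)"
    proof (cases "x \<in> s")
      case True
      have "cont (fst A) (snd A) (lift (fst B)) (rle (snd B)) (\<lambda>d. \<rho> s (f x (\<pi> s d)))"
        using cont_comp[OF cont_comp[OF deflations_cont[OF \<pi> s] funsp_cont[OF f x] A A]
            deflations_cont[OF \<rho> s] A BL] .
      then show ?thesis by (rule cont_cong) (use True x in \<open>simp add: \<phi>_def\<close>)
    next
      case False
      then show ?thesis unfolding \<phi>_def by (simp add: cont_const[OF BL])
    qed
  qed (auto simp: \<phi>_def)
  show ?thesis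
    unfolding deflations_def
  proof (intro conjI ballI)
    fix s :: "'a set" assume "s \<in> Fin"
    then have s: "finite s" by simp
    have \<pi>A: "\<pi> s d \<in> fst A" if "d \<in> fst A" for d using cont_mem[OF deflations_cont[OF \<pi> s] that] .
    show "cont (funsp Args A B) (funle Args A B) (funsp Args A B) (funle Args A B) (\<phi> s)"
    proof (rule contI)
      fix X f assume X: "dir X (funle Args A B)"
        and lim: "dlim (funsp Args A B) (funle Args A B) X (funle Args A B) (\<lambda>x. x) f"
      show "dlim (funsp Args A B) (funle Args A B) X (funle Args A B) (\<phi> s) (\<phi> s f)"
      proof (rule dlim_funspI)
        show "dlim (lift (fst B)) (rle (snd B)) X (funle Args A B) (\<lambda>f. \<phi> s f x d) (\<phi> s f x d)"
          if xd: "x \<in> Args" "d \<in> fst A" for x d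
        proof (cases "x \<in> s")
          case True
          then show ?thesis unfolding \<phi>_def using xd
            cont_dlim[OF deflations_cont[OF \<rho> s] BL X dlim_funspD[OF A B X lim xd(1) \<pi>A[OF xd(2)]]]
            by simp
        next
          case False
          then show ?thesis unfolding \<phi>_def by (simp add: dlim_const[OF BL X])
        qed
      qed (use in_F[OF s] dlim_mem[OF lim] dlim_in[OF lim] in blast)+
    qed (rule in_F[OF s])
    \<comment> \<open>\<open>\<phi> s f\<close> is read off a finite table: finitely many arguments
      \<open>x\<close>, finitely many approximated \<open>d\<close>, and entries in the finite range
      of \<open>\<rho> s\<close>.\<close>
    let ?E = "PiE (s \<times> \<pi> s ` fst A) (\<lambda>_. \<rho> s ` lift (fst B))"
    let ?\<Phi> = "\<lambda>g x d. if x \<in> s \<and> x \<in> Args \<and> d \<in> fst A then g (x, \<pi> s d) else RBot"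
    have "\<phi> s f \<in> ?\<Phi> ` ?E" if f: "f \<in> funsp Args A B" for f
    proof
      \<comment> \<open>For \<open>x\<close> in \<open>s\<close> but outside \<open>Args\<close> the
        table needs some entry; \<open>RBot\<close> keeps it within the range of
        \<open>\<rho> s\<close>.\<close>
      let ?g = "restrict (\<lambda>(x, a). \<rho> s (if x \<in> Args then f x a else RBot)) (s \<times> \<pi> s ` fst A)"
      show "\<phi> s f = ?\<Phi> ?g" unfolding \<phi>_def by (auto simp: fun_eq_iff)
      show "?g \<in> ?E" using funsp_mem[OF f] \<pi>A by auto
    qed
    then have "\<phi> s ` funsp Args A B \<subseteq> ?\<Phi> ` ?E" by (rule image_subsetI)
    moreover have "finite ?E"
      by (rule finite_PiE) (simp_all add: s deflations_finite[OF \<pi> s] deflations_finite[OF \<rho> s])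
    ultimately show "finite (\<phi> s ` funsp Args A B)"
      using finite_subset finite_imageI by blast
  next
    fix f assume f: "f \<in> funsp Args A B"
    show "dlim (funsp Args A B) (funle Args A B) Fin (\<subseteq>) (\<lambda>s. \<phi> s f) f"
    proof (rule dlim_funspI)
      fix x d assume xd: "x \<in> Args" "d \<in> fst A"
      \<comment> \<open>The approximation of the result and that of the argument get separate
        indices in \<open>?F\<close>; \<open>?G\<close> is its limit in the second one and
        \<open>\<phi>\<close> its diagonal.\<close>
      let ?G = "\<lambda>s. if x \<in> s then \<rho> s (f x d) else RBot"
      let ?F = "\<lambda>s s'. if x \<in> s then \<rho> s (f x (\<pi> s' d)) else RBot"
      have \<rho>_lim: "dlim (lift (fst B)) (rle (snd B)) Fin (\<subseteq>) (\<lambda>s. \<rho> s (f x a)) (f x a)"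
        if "a \<in> fst A" for a using deflations_dlim[OF \<rho> funsp_mem[OF f xd(1) that]] .
      have \<pi>A: "\<pi> s d \<in> fst A" if "finite s" for s
        using cont_mem[OF deflations_cont[OF \<pi> that] xd(2)] .
      have G: "dlim (lift (fst B)) (rle (snd B)) Fin (\<subseteq>) ?G (f x d)"
      proof (rule dlimI)
        fix y assume y: "y \<in> lift (fst B)" "\<And>s. s \<in> Fin \<Longrightarrow> rle (snd B) (?G s) y"
        show "rle (snd B) (f x d) y"
        proof (rule dlim_least[OF \<rho>_lim[OF xd(2)] y(1)])
          fix s :: "'a set" assume s: "s \<in> Fin"
          \<comment> \<open>\<open>?G\<close> is \<open>RBot\<close> until \<open>x\<close> has
            entered the index; the finite sets containing \<open>x\<close> are cofinal.\<close>
          then have s': "insert x s \<in> Fin" by simp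
          show "rle (snd B) (\<rho> s (f x d)) y"
            by (rule po_trans[OF BL dlim_mono[OF \<rho>_lim[OF xd(2)] s s' subset_insertI]])
              (use y(2)[OF s'] y(1) dlim_mem[OF \<rho>_lim[OF xd(2)]] s s' in auto)
        qed
      qed (use dlimD(1-4)[OF \<rho>_lim[OF xd(2)]] in auto)
      have "dlim (lift (fst B)) (rle (snd B)) Fin (\<subseteq>) (\<lambda>s. ?F s s) (f x d)"
      proof (rule dlim_diag[where F = ?F, OF dir_Fin BL _ G])
        fix s :: "'a set" assume "s \<in> Fin"
        then have s: "finite s" by simp
        show "dlim (lift (fst B)) (rle (snd B)) Fin (\<subseteq>) (\<lambda>s'. ?F s s') (?G s)"
          using cont_dlim[OF deflations_cont[OF \<rho> s] BL dir_Fin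
              cont_dlim[OF funsp_cont[OF f xd(1)] A dir_Fin deflations_dlim[OF \<pi> xd(2)]]]
          by (simp add: dlim_const[OF BL dir_Fin])
      next
        fix i j k :: "'a set" assume ijk: "i \<in> Fin" "j \<in> Fin" "k \<in> Fin" "i \<subseteq> j"
        then show "rle (snd B) (?F i k) (?F j k)"
          using dlim_mono[OF \<rho>_lim[OF \<pi>A, of k], of i j] by auto
      qed
      then show "dlim (lift (fst B)) (rle (snd B)) Fin (\<subseteq>) (\<lambda>s. \<phi> s f x d) (f x d)"
        unfolding \<phi>_def using xd by simp
    qed (use in_F f in auto)
  qed
qed

section \<open>Cardinality of the function spaces\<close>

unbundle cardinal_syntax

lemma finite_ordLeq_infinite: "finite A \<Longrightarrow> infinite B \<Longrightarrow> |A| \<le>o |B|"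
  using card_of_ordLeq_finite ordLeq_total[OF card_of_Well_order card_of_Well_order] by blast

lemma card_of_prod_UNIV:
  assumes "infinite B" "|UNIV :: 'a set| \<le>o |B|" "|UNIV :: 'c set| \<le>o |B|"
  shows "|UNIV :: ('a \<times> 'c) set| \<le>o |B|"
  using card_of_Sigma_ordLeq_infinite[OF assms(1,2), of "\<lambda>_. UNIV :: 'c set"] assms(3) by simp

text \<open>Induction on the number of elements: the sets of size \<open>Suc n\<close> are covered
  by one image of \<open>?N n\<close> for each element of \<open>'a\<close>, and an infinite
  cardinal absorbs such unions. Measuring against \<open>'b\<close> treats finite and infinite
  \<open>'a\<close> alike.\<close>

lemma card_of_Fin:
  assumes B: "infinite (UNIV :: 'b set)" and AB: "|UNIV :: 'a set| \<le>o |UNIV :: 'b set|"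
  shows "|Fin :: 'a set set| \<le>o |UNIV :: 'b set|"
proof -
  let ?N = "\<lambda>n. {s :: 'a set. finite s \<and> card s = n}"
  have N: "|?N n| \<le>o |UNIV :: 'b set|" for n
  proof (induction n)
    case 0
    have "?N 0 = {{}}" by auto
    then show ?case using B by (simp add: finite_ordLeq_infinite)
  next
    case (Suc n)
    have "?N (Suc n) \<subseteq> (\<Union>a. insert a ` ?N n)"
    proof
      fix s assume s: "s \<in> ?N (Suc n)"
      then obtain a t where "s = insert a t" "a \<notin> t" by (metis (mono_tags, lifting) card_Suc_eq mem_Collect_eq)
      then have "t \<in> ?N n" using s by auto
      then show "s \<in> (\<Union>a. insert a ` ?N n)" using \<open>s = insert a t\<close> by blast
    qed
    moreover have "|\<Union>a. insert a ` ?N n| \<le>o |UNIV :: 'b set|"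
      using Suc card_of_image ordLeq_transitive by (intro card_of_UNION_ordLeq_infinite[OF B AB]) blast
    ultimately show ?case using card_of_mono1 ordLeq_transitive by blast
  qed
  have "(Fin :: 'a set set) = (\<Union>n. ?N n)" by auto
  moreover have "|UNIV :: nat set| \<le>o |UNIV :: 'b set|" using B infinite_iff_card_of_nat by blast
  ultimately show ?thesis
    using card_of_UNION_ordLeq_infinite[OF B, of "UNIV :: nat set" ?N] N by (metis (no_types, lifting))
qed

text \<open>A function is stored as its graph over the dense set \<open>K\<close>. A point of that
  graph is a tuple of an argument, an element of \<open>K\<close> and an element of a coded result;
  such tuples fit into \<open>'b\<close>, so a graph is a subset of \<open>'b\<close>. Two functions
  with the same graph agree everywhere, being limits along \<open>\<pi> s d\<close> of the same
  values.\<close>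

lemma funsp_injection:
  fixes \<pi> :: "'a set \<Rightarrow> 'b set \<Rightarrow> 'b set" and A B :: "'b set cpo"
  assumes inf: "infinite (UNIV :: 'b set)" and card: "|UNIV :: 'a set| \<le>o |UNIV :: 'b set|"
    and A: "po (fst A) (snd A)" and B: "po (fst B) (snd B)"
    and \<pi>: "deflations (fst A) (snd A) \<pi>"
  shows "\<exists>i :: ('a \<Rightarrow> 'b set \<Rightarrow> 'b set res) \<Rightarrow> 'b set. inj_on i (funsp Args A B)"
proof -
  define K where "K = (\<Union>s\<in>Fin. \<pi> s ` fst A)"
  have "|K| \<le>o |UNIV :: 'b set|" unfolding K_def
  proof (rule card_of_UNION_ordLeq_infinite[OF inf card_of_Fin[OF inf card]], rule ballI)
    fix s :: "'a set" assume "s \<in> Fin"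
    then have "finite (\<pi> s ` fst A)" using deflations_finite[OF \<pi>] by simp
    then show "|\<pi> s ` fst A| \<le>o |UNIV :: 'b set|"
      using inf by (simp add: finite_ordLeq_infinite)
  qed
  \<comment> \<open>Elements of \<open>K\<close> are sets over \<open>'b\<close>, but so few that a
    single element of \<open>'b\<close> can name each of them.\<close>
  then obtain c :: "'b set \<Rightarrow> 'b" where c: "inj_on c K" unfolding card_of_ordLeq[symmetric] by blast
  have "|UNIV :: ('a \<times> 'b \<times> bool \<times> 'b) set| \<le>o |UNIV :: 'b set|"
    by (intro card_of_prod_UNIV inf card card_of_mono1 subset_UNIV finite_ordLeq_infinite finite_UNIV)
  then obtain g :: "'a \<times> 'b \<times> bool \<times> 'b \<Rightarrow> 'b" where g: "inj g"
    unfolding card_of_ordLeq[symmetric] by auto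
  \<comment> \<open>The \<open>False\<close> half is empty for values and full for the two adjoined
    results, which the \<open>True\<close> half then separates. In \<open>decode\<close>,
    \<open>undefined\<close> is just some element at which fullness is tested.\<close>
  define code :: "'b set res \<Rightarrow> (bool \<times> 'b) set" where
    "code r = (case r of RBot \<Rightarrow> UNIV | RStar \<Rightarrow> {False} \<times> UNIV | RV u \<Rightarrow> {True} \<times> u)" for r
  define decode :: "(bool \<times> 'b) set \<Rightarrow> 'b set res" where
    "decode X = (if (False, undefined) \<notin> X then RV {b. (True, b) \<in> X}
       else if (True, undefined) \<in> X then RBot else RStar)" for X
  have "decode (code r) = r" for r
    by (cases r) (simp_all add: decode_def code_def)
  then have code: "r = r'" if "code r = code r'" for r r'
    using that by metis
  define i where "i f = g ` {(x, c k, b) |x k b. k \<in> K \<and> b \<in> code (f x k)}" for f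
  have "f = f'" if f: "f \<in> funsp Args A B" and f': "f' \<in> funsp Args A B" and eq: "i f = i f'" for f f'
  proof (intro ext)
    have sub: "code (h x k) \<subseteq> code (h' x k)" if "i h = i h'" "k \<in> K" for h h' x k
    proof
      fix b assume "b \<in> code (h x k)"
      then have "g (x, c k, b) \<in> i h" using that(2) unfolding i_def by blast
      then have "g (x, c k, b) \<in> i h'" using that(1) by simp
      then obtain x' k' b' where *: "g (x, c k, b) = g (x', c k', b')" "k' \<in> K" "b' \<in> code (h' x' k')"
        unfolding i_def by blast
      then have "x' = x" "b' = b" "c k = c k'" using injD[OF g *(1)] by simp_all
      then show "b \<in> code (h' x k)" using * inj_onD[OF c, of k k'] that(2) by simp
    qed
    have K: "f x k = f' x k" if "k \<in> K" for x k
      using sub[OF eq that] sub[OF eq[symmetric] that] code by blast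
    fix x d
    show "f x d = f' x d"
    proof (cases "x \<in> Args \<and> d \<in> fst A")
      case True
      have lim: "dlim (lift (fst B)) (rle (snd B)) Fin (\<subseteq>) (\<lambda>s. h x (\<pi> s d)) (h x d)"
        if "h \<in> funsp Args A B" for h
        using cont_dlim[OF funsp_cont[OF that] A dir_Fin deflations_dlim[OF \<pi>]] True by blast
      have "f x (\<pi> s d) = f' x (\<pi> s d)" if "s \<in> Fin" for s
        using K True that unfolding K_def by blast
      then have "dlim (lift (fst B)) (rle (snd B)) Fin (\<subseteq>) (\<lambda>s. f' x (\<pi> s d)) (f x d)"
        using lim[OF f] dlim_cong[of Fin] by (metis (mono_tags, lifting))
      then show ?thesis using dlim_unique[OF po_lift[OF B] _ lim[OF f']] by blast
    next
      case False
      then show ?thesis using funsp_out[OF f, of x d] funsp_out[OF f', of x d] by auto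
    qed
  qed
  then show ?thesis unfolding inj_on_def by blast
qed

section \<open>Least fixed points\<close>

text \<open>Kleene's theorem, keeping two extras: leastness among prefixed points, by which fixed
  points of different maps are compared, and the chain itself, along which relations pass to the
  limit.\<close>

lemma least_fixed_point:
  assumes A: "dcpo A le" and bot: "b \<in> A" "\<And>x. x \<in> A \<Longrightarrow> le b x" and G: "cont A le A le G"
  obtains g where "g \<in> A" "G g = g" "\<And>x. x \<in> A \<Longrightarrow> le (G x) x \<Longrightarrow> le g x"
    "dlim A le UNIV (\<le>) (\<lambda>n. (G ^^ n) b) g"
proof -
  note po = dcpo_po[OF A]
  have dir: "dir (UNIV :: nat set) (\<le>)"
    unfolding dir_def by (metis UNIV_I empty_iff nat_le_linear order_refl)
  have mem: "(G ^^ n) b \<in> A" for n by (induction n) (simp_all add: bot(1) cont_mem[OF G])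
  have step: "le ((G ^^ n) b) ((G ^^ Suc n) b)" for n
  proof (induction n)
    case (Suc n)
    then show ?case using cont_mono[OF G po] mem[of n] mem[of "Suc n"] by simp
  qed (simp add: bot cont_mem[OF G])
  have mono: "le ((G ^^ m) b) ((G ^^ n) b)" if "m \<le> n" for m n
    using that
  proof (induction rule: dec_induct)
    case (step n)
    then show ?case using po_trans[OF po _ \<open>\<And>n. le ((G ^^ n) b) ((G ^^ Suc n) b)\<close>] mem by blast
  qed (rule po_refl[OF po mem])
  obtain g where g: "dlim A le UNIV (\<le>) (\<lambda>n. (G ^^ n) b) g"
    by (rule dcpo_dlim[where f = "\<lambda>n. (G ^^ n) b", OF A dir mem mono])
  have Gg: "dlim A le UNIV (\<le>) (\<lambda>n. (G ^^ Suc n) b) (G g)"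
    using cont_dlim[OF G po dir g] by simp
  \<comment> \<open>Dropping the first term leaves the limit of the chain unchanged, while
    \<open>G\<close> shifts the chain by one.\<close>
  have "dlim A le UNIV (\<le>) (\<lambda>n. (G ^^ Suc n) b) g"
  proof (rule dlimI)
    fix y assume y: "y \<in> A" "\<And>n. n \<in> UNIV \<Longrightarrow> le ((G ^^ Suc n) b) y"
    show "le g y"
    proof (rule dlim_least[OF g y(1)])
      show "le ((G ^^ n) b) y" for n
        by (rule po_trans[OF po step y(2)]) (use mem y(1) in blast)+
    qed
  next
    show "(G ^^ Suc n) b \<in> A" for n by (rule mem)
    show "le ((G ^^ Suc i) b) ((G ^^ Suc j) b)" if "i \<le> j" for i j by (rule mono) (use that in simp)
    show "g \<in> A" by (rule dlim_in[OF g])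
    show "le ((G ^^ Suc n) b) g" for n by (rule dlim_le[OF g UNIV_I])
  qed
  then have "G g = g" using dlim_unique[OF po Gg] by blast
  moreover have "le g x" if x: "x \<in> A" "le (G x) x" for x
  proof (rule dlim_least[OF g x(1)])
    fix n
    show "le ((G ^^ n) b) x"
    proof (induction n)
      case (Suc n)
      have "le (G ((G ^^ n) b)) (G x)" using cont_mono[OF G po Suc mem x(1)] .
      then show ?case using po_trans[OF po _ x(2) _ cont_mem[OF G x(1)] x(1)] mem[of "Suc n"] by simp
    qed (simp add: bot(2) x(1))
  qed
  ultimately show thesis using that dlim_in[OF g] g by blast
qed

section \<open>The semantic domains\<close>

declare dom.simps [simp del]

text \<open>\<open>name\<close> bounds the number of arguments by the number of stacks, the cardinal
  against which the universe is measured.\<close>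

locale arguments =
  fixes Args :: "'a set" and name :: "'a \<Rightarrow> ('n, 'p) stack"
  assumes inj_name: "inj name"
begin

abbreviation Dom :: "ty \<Rightarrow> ('n, 'p) univ set" where "Dom t \<equiv> fst (dom Args t)"
abbreviation Le :: "ty \<Rightarrow> ('n, 'p) univ \<Rightarrow> ('n, 'p) univ \<Rightarrow> bool" where "Le t \<equiv> snd (dom Args t)"
abbreviation Fun :: "ty \<Rightarrow> ty \<Rightarrow> ('a \<Rightarrow> ('n, 'p) univ \<Rightarrow> ('n, 'p) univ res) set" where "Fun t1 t2 \<equiv> fsp Args t1 t2"
abbreviation Enc :: "ty \<Rightarrow> ty \<Rightarrow> _ \<Rightarrow> ('n, 'p) univ" where "Enc t1 t2 \<equiv> enc (Fun t1 t2)"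
abbreviation Dec :: "ty \<Rightarrow> ty \<Rightarrow> ('n, 'p) univ \<Rightarrow> _" where "Dec t1 t2 \<equiv> dec (Fun t1 t2)"
abbreviation "FunLe t1 t2 \<equiv> funle Args (dom Args t1) (dom Args t2)"
abbreviation "rlim t \<equiv> dlim (lift (Dom t)) (rle (Le t))"

lemma Dom_TFun: "Dom (TFun t1 t2) = Enc t1 t2 ` Fun t1 t2"
  and Le_TFun: "Le (TFun t1 t2) = (\<lambda>u v. FunLe t1 t2 (Dec t1 t2 u) (Dec t1 t2 v))"
  by (simp_all add: dom.simps fsp_def Let_def)

text \<open>Here the Hilbert choice in \<open>enc\<close> is justified. Stacks are lists over an
  inhabited type and hence infinitely many, whatever the principals and privileges are.\<close>

lemma order_embedding_enc:
  assumes "po (Dom t1) (Le t1)" "po (Dom t2) (Le t2)"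
    and "deflations (Dom t1) (Le t1) (\<pi> :: 'a set \<Rightarrow> _)"
  shows "order_embedding (Fun t1 t2) (Enc t1 t2) (Dec t1 t2)"
proof -
  have inf: "infinite (UNIV :: ('n, 'p) stack set)" by (rule infinite_UNIV_listI)
  have "|UNIV :: 'a set| \<le>o |UNIV :: ('n, 'p) stack set|"
    using inj_name by (intro card_of_ordLeqI) auto
  then have "\<exists>i :: _ \<Rightarrow> ('n, 'p) univ. inj_on i (Fun t1 t2)"
    unfolding fsp_def by (rule funsp_injection[OF inf _ assms])
  then have "inj_on (Enc t1 t2) (Fun t1 t2)"
    unfolding enc_def by (rule someI_ex)
  then show ?thesis unfolding order_embedding_def dec_def by simp
qed

text \<open>The two claims need a joint induction: the order at \<open>TFun t1 t2\<close> is
  sensible only if encoding is injective, injectivity uses the deflations at \<open>t1\<close>, and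
  the deflations at the function type are built from those at both components.\<close>

lemma dcpo_deflations_dom:
  "dcpo (Dom t) (Le t) \<and> (\<exists>\<pi> :: 'a set \<Rightarrow> _. deflations (Dom t) (Le t) \<pi>)"
proof (induction t)
  case TBool
  have po: "po (Dom TBool) (Le TBool)" by (simp add: po_def dom.simps)
  have "dcpo (Dom TBool) (Le TBool)"
    unfolding dcpo_def
  proof (intro conjI allI impI po)
    fix X assume X: "directed (Dom TBool) (Le TBool) X"
    then obtain x where x: "x \<in> X" "x \<in> Dom TBool" unfolding directed_def by blast
    have "y = x" if "y \<in> X" for y
      using X x(1) that unfolding directed_def by (auto simp: dom.simps)
    then have "X = {x}" using x(1) by blast
    then have "is_lub (Dom TBool) (Le TBool) X x"
      using x(2) by (simp add: is_lub_def dom.simps)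
    then show "\<exists>l. is_lub (Dom TBool) (Le TBool) X l" ..
  qed
  moreover have "deflations (Dom TBool) (Le TBool) (\<lambda>(s :: 'a set) u. u)"
    unfolding deflations_def
  proof (intro conjI ballI)
    show "cont (Dom TBool) (Le TBool) (Dom TBool) (Le TBool) (\<lambda>u. u)" by (simp add: cont_def)
    show "finite ((\<lambda>u. u) ` Dom TBool)" by (simp add: dom.simps)
    show "dlim (Dom TBool) (Le TBool) Fin (\<subseteq>) (\<lambda>s :: 'a set. a) a" if "a \<in> Dom TBool" for a
      by (rule dlim_const[OF po dir_Fin that])
  qed
  ultimately show ?case by blast
next
  case (TFun t1 t2)
  then obtain \<pi>1 \<pi>2 :: "'a set \<Rightarrow> ('n, 'p) univ \<Rightarrow> ('n, 'p) univ"
    where D1: "dcpo (Dom t1) (Le t1)" and \<pi>1: "deflations (Dom t1) (Le t1) \<pi>1"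
      and D2: "dcpo (Dom t2) (Le t2)" and \<pi>2: "deflations (Dom t2) (Le t2) \<pi>2" by blast
  note P1 = dcpo_po[OF D1] and P2 = dcpo_po[OF D2]
  let ?F = "Fun t1 t2"
  interpret E: order_embedding ?F "FunLe t1 t2" "Enc t1 t2" "Dec t1 t2"
    by (rule order_embedding_enc[OF P1 P2 \<pi>1])
  have F: "dcpo ?F (FunLe t1 t2)" unfolding fsp_def using dcpo_funsp[OF P1 D2] .
  from deflations_funsp[OF P1 D2 \<pi>1 deflations_lift[OF P2 \<pi>2], of Args]
  obtain \<phi> :: "'a set \<Rightarrow> _" where \<phi>: "deflations ?F (FunLe t1 t2) \<phi>" unfolding fsp_def by blast
  let ?A = "Dom (TFun t1 t2)" and ?le = "Le (TFun t1 t2)"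
  have \<phi>F: "\<phi> s f \<in> ?F" if "finite s" "f \<in> ?F" for s f
    using cont_mem[OF deflations_cont[OF \<phi> that(1)] that(2)] .
  let ?\<psi> = "\<lambda>s u. Enc t1 t2 (\<phi> s (Dec t1 t2 u))"
  have "deflations ?A ?le ?\<psi>"
    unfolding deflations_def Dom_TFun Le_TFun
  proof (intro conjI ballI)
    fix s :: "'a set" assume "s \<in> Fin"
    then have s: "finite s" by simp
    show "cont E.A E.leA E.A E.leA (?\<psi> s)"
    proof (rule contI)
      show "?\<psi> s u \<in> E.A" if "u \<in> E.A" for u using \<phi>F[OF s E.d_mem[OF that]] by blast
      fix X l assume X: "dir X E.leA" and lim: "dlim E.A E.leA X E.leA (\<lambda>x. x) l"
      then have X_A: "\<And>u. u \<in> X \<Longrightarrow> u \<in> E.A" and l_A: "l \<in> E.A"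
        and lim': "dlim ?F (FunLe t1 t2) X E.leA (\<lambda>u. Dec t1 t2 u) (Dec t1 t2 l)"
        unfolding E.dlim_iff by blast+
      have d\<psi>: "Dec t1 t2 (?\<psi> s u) = \<phi> s (Dec t1 t2 u)" if "u \<in> E.A" for u
        using E.d_e[OF \<phi>F[OF s E.d_mem[OF that]]] .
      have "dlim ?F (FunLe t1 t2) X E.leA (\<lambda>u. Dec t1 t2 (?\<psi> s u)) (\<phi> s (Dec t1 t2 l))"
        using cont_dlim[OF deflations_cont[OF \<phi> s] dcpo_po[OF F] X lim'] d\<psi>[OF X_A]
          dlim_cong[of X "\<lambda>u. Dec t1 t2 (?\<psi> s u)" "\<lambda>u. \<phi> s (Dec t1 t2 u)"] by simp
      then show "dlim E.A E.leA X E.leA (?\<psi> s) (?\<psi> s l)"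
        unfolding E.dlim_iff using \<phi>F[OF s E.d_mem] X_A l_A d\<psi>[OF l_A] by auto
    qed
    have "?\<psi> s ` E.A \<subseteq> Enc t1 t2 ` \<phi> s ` ?F" using E.d_e by auto
    then show "finite (?\<psi> s ` E.A)" using deflations_finite[OF \<phi> s] finite_subset by blast
  next
    fix u assume u: "u \<in> E.A"
    have "Dec t1 t2 (?\<psi> s u) = \<phi> s (Dec t1 t2 u)" if "s \<in> Fin" for s
      using E.d_e[OF \<phi>F[OF _ E.d_mem[OF u]]] that by simp
    then have "dlim ?F (FunLe t1 t2) Fin (\<subseteq>) (\<lambda>s. Dec t1 t2 (?\<psi> s u)) (Dec t1 t2 u)"
      using deflations_dlim[OF \<phi> E.d_mem[OF u]]
        dlim_cong[of Fin "\<lambda>s. Dec t1 t2 (?\<psi> s u)" "\<lambda>s. \<phi> s (Dec t1 t2 u)"] by simp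
    then show "dlim E.A E.leA Fin (\<subseteq>) (\<lambda>s. ?\<psi> s u) u"
      unfolding E.dlim_iff using u \<phi>F[OF _ E.d_mem[OF u]] by auto
  qed
  moreover have "dcpo ?A ?le" unfolding Dom_TFun Le_TFun by (rule E.dcpo[OF F])
  ultimately show ?case by blast
qed

lemma dcpo_Dom: "dcpo (Dom t) (Le t)"
  and po_Dom: "po (Dom t) (Le t)"
  and po_lift_Dom: "po (lift (Dom t)) (rle (Le t))"
  using dcpo_deflations_dom dcpo_po po_lift by blast+

lemma order_embedding_Fun:
  "order_embedding (Fun t1 t2) (Enc t1 t2) (Dec t1 t2)"
proof -
  obtain \<pi> :: "'a set \<Rightarrow> _" where "deflations (Dom t1) (Le t1) \<pi>" using dcpo_deflations_dom by blast
  then show ?thesis using order_embedding_enc po_Dom by blast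
qed

lemma Fun_cont: "f \<in> Fun t1 t2 \<Longrightarrow> x \<in> Args \<Longrightarrow> cont (Dom t1) (Le t1) (lift (Dom t2)) (rle (Le t2)) (f x)"
  unfolding fsp_def by (rule funsp_cont)

lemma dlim_FunI:
  assumes "\<And>i. i \<in> I \<Longrightarrow> fs i \<in> Fun t1 t2" "f \<in> Fun t1 t2"
    and "\<And>x d. x \<in> Args \<Longrightarrow> d \<in> Dom t1 \<Longrightarrow> rlim t2 I r (\<lambda>i. fs i x d) (f x d)"
  shows "dlim (Fun t1 t2) (FunLe t1 t2) I r fs f"
  using assms unfolding fsp_def by (rule dlim_funspI)

lemma dec_mem: "u \<in> Dom (TFun t1 t2) \<Longrightarrow> Dec t1 t2 u \<in> Fun t1 t2"
  unfolding Dom_TFun by (rule order_embedding.d_mem[OF order_embedding_Fun])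

lemma dlim_TFun_iff: "dlim (Dom (TFun t1 t2)) (Le (TFun t1 t2)) I r us u \<longleftrightarrow>
    (\<forall>i\<in>I. us i \<in> Dom (TFun t1 t2)) \<and> u \<in> Dom (TFun t1 t2) \<and>
    dlim (Fun t1 t2) (FunLe t1 t2) I r (\<lambda>i. Dec t1 t2 (us i)) (Dec t1 t2 u)"
  unfolding Dom_TFun Le_TFun by (rule order_embedding.dlim_iff[OF order_embedding_Fun])

lemma cont_appv:
  assumes "u \<in> Dom (TFun t1 t2)" "x \<in> Args"
  shows "cont (Dom t1) (Le t1) (lift (Dom t2)) (rle (Le t2)) (appv Args t1 t2 u x)"
  unfolding appv_def using Fun_cont[OF dec_mem[OF assms(1)] assms(2)] .

text \<open>Limits of codes are limits of the decoded functions, and these are pointwise by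
  \<open>dlim_funspD\<close>.\<close>

lemma appv_dlim:
  assumes "dir I r" "dlim (Dom (TFun t1 t2)) (Le (TFun t1 t2)) I r us u" "x \<in> Args" "d \<in> Dom t1"
  shows "rlim t2 I r (\<lambda>i. appv Args t1 t2 (us i) x d) (appv Args t1 t2 u x d)"
  unfolding appv_def using assms(2) unfolding dlim_TFun_iff fsp_def
  by (intro dlim_funspD[OF po_Dom dcpo_Dom assms(1) _ assms(3,4)]) blast

lemma cont_appv_fun:
  assumes "x \<in> Args" "d \<in> Dom t1"
  shows "cont (Dom (TFun t1 t2)) (Le (TFun t1 t2)) (lift (Dom t2)) (rle (Le t2)) (\<lambda>u. appv Args t1 t2 u x d)"
  using assms by (intro contI appv_dlim cont_mem[OF cont_appv])

section \<open>Coded closures and recursion at a fixed function type\<close>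

context
  fixes t1 t2 :: ty
begin

text \<open>Functions before the normalisation performed by \<open>mkfun\<close>. Continuity is what
  puts the normalised function into \<open>Fun t1 t2\<close>, where \<open>Dec\<close> inverts
  \<open>Enc\<close>, so that the beta rule \<open>appv_mkfun\<close> holds.\<close>

definition bodies :: "('a \<Rightarrow> ('n, 'p) univ \<Rightarrow> ('n, 'p) univ res) set" where
  "bodies = {f. \<forall>x\<in>Args. cont (Dom t1) (Le t1) (lift (Dom t2)) (rle (Le t2)) (f x)}"

lemma body_Fun:
  assumes "f \<in> bodies"
  shows "(\<lambda>x d. if x \<in> Args \<and> d \<in> Dom t1 then f x d else RBot) \<in> Fun t1 t2"
  unfolding fsp_def
proof (rule funspI)
  fix x assume x: "x \<in> Args"
  then have "cont (Dom t1) (Le t1) (lift (Dom t2)) (rle (Le t2)) (f x)"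
    using assms unfolding bodies_def by blast
  then show "cont (Dom t1) (Le t1) (lift (Dom t2)) (rle (Le t2)) (\<lambda>d. if x \<in> Args \<and> d \<in> Dom t1 then f x d else RBot)"
    by (rule cont_cong) (simp add: x)
qed auto

lemma dec_mkfun:
  assumes "f \<in> bodies"
  shows "Dec t1 t2 (mkfun Args t1 t2 f) = (\<lambda>x d. if x \<in> Args \<and> d \<in> Dom t1 then f x d else RBot)"
  unfolding mkfun_def using order_embedding.d_e[OF order_embedding_Fun body_Fun[OF assms]] .

lemma mkfun_Dom: "f \<in> bodies \<Longrightarrow> mkfun Args t1 t2 f \<in> Dom (TFun t1 t2)"
  unfolding mkfun_def Dom_TFun by (intro imageI body_Fun)

lemma appv_mkfun: "f \<in> bodies \<Longrightarrow> x \<in> Args \<Longrightarrow> d \<in> Dom t1 \<Longrightarrow> appv Args t1 t2 (mkfun Args t1 t2 f) x d = f x d"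
  unfolding appv_def by (simp add: dec_mkfun)

lemma mkfun_dlim:
  assumes fs: "\<And>i. i \<in> I \<Longrightarrow> fs i \<in> bodies" and f: "f \<in> bodies"
    and lim: "\<And>x d. x \<in> Args \<Longrightarrow> d \<in> Dom t1 \<Longrightarrow> rlim t2 I r (\<lambda>i. fs i x d) (f x d)"
  shows "dlim (Dom (TFun t1 t2)) (Le (TFun t1 t2)) I r (\<lambda>i. mkfun Args t1 t2 (fs i)) (mkfun Args t1 t2 f)"
  unfolding dlim_TFun_iff
proof (intro conjI ballI mkfun_Dom fs f)
  show "dlim (Fun t1 t2) (FunLe t1 t2) I r (\<lambda>i. Dec t1 t2 (mkfun Args t1 t2 (fs i)))
      (Dec t1 t2 (mkfun Args t1 t2 f))"
    unfolding dec_mkfun[OF f]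
  proof (rule dlim_FunI)
    show "Dec t1 t2 (mkfun Args t1 t2 (fs i)) \<in> Fun t1 t2" if "i \<in> I" for i
      by (rule dec_mem[OF mkfun_Dom[OF fs[OF that]]])
    show "(\<lambda>x d. if x \<in> Args \<and> d \<in> Dom t1 then f x d else RBot) \<in> Fun t1 t2"
      by (rule body_Fun[OF f])
    fix x d assume xd: "x \<in> Args" "d \<in> Dom t1"
    have "Dec t1 t2 (mkfun Args t1 t2 (fs i)) x d = fs i x d" if "i \<in> I" for i
      using xd by (simp add: dec_mkfun[OF fs[OF that]])
    then have "rlim t2 I r (\<lambda>i. Dec t1 t2 (mkfun Args t1 t2 (fs i)) x d) (f x d)"
      using lim[OF xd] dlim_cong[of I "\<lambda>i. Dec t1 t2 (mkfun Args t1 t2 (fs i)) x d" "\<lambda>i. fs i x d"]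
      by simp
    then show "rlim t2 I r (\<lambda>i. Dec t1 t2 (mkfun Args t1 t2 (fs i)) x d)
        (if x \<in> Args \<and> d \<in> Dom t1 then f x d else RBot)" using xd by simp
  qed
qed

definition bottom :: "('n, 'p) univ" where
  "bottom = mkfun Args t1 t2 (\<lambda>_ _. RBot)"

lemma RBot_bodies: "(\<lambda>_ _. RBot) \<in> bodies"
  unfolding bodies_def by (simp add: cont_const[OF po_lift_Dom])

lemma bottom_Dom: "bottom \<in> Dom (TFun t1 t2)"
  unfolding bottom_def by (rule mkfun_Dom[OF RBot_bodies])

lemma bottom_le: "Le (TFun t1 t2) bottom u"
  unfolding bottom_def Le_TFun by (simp add: dec_mkfun[OF RBot_bodies] funle_def)

text \<open>The description denotes, since antisymmetry makes a least fixed point unique. The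
  stronger leastness serves \<open>fix_lim\<close>, the Kleene chain serves the logical
  relation.\<close>

lemma fixv:
  assumes G: "cont (Dom (TFun t1 t2)) (Le (TFun t1 t2)) (Dom (TFun t1 t2)) (Le (TFun t1 t2)) G"
  shows fixv_Dom: "fixv Args (TFun t1 t2) G \<in> Dom (TFun t1 t2)"
    and fixv_eq: "G (fixv Args (TFun t1 t2) G) = fixv Args (TFun t1 t2) G"
    and fixv_least: "\<And>u. u \<in> Dom (TFun t1 t2) \<Longrightarrow> Le (TFun t1 t2) (G u) u \<Longrightarrow> Le (TFun t1 t2) (fixv Args (TFun t1 t2) G) u"
    and fixv_dlim: "dlim (Dom (TFun t1 t2)) (Le (TFun t1 t2)) UNIV (\<le>) (\<lambda>n. (G ^^ n) bottom) (fixv Args (TFun t1 t2) G)"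
proof -
  let ?D = "Dom (TFun t1 t2)" and ?le = "Le (TFun t1 t2)"
  obtain g where g: "g \<in> ?D" "G g = g" "\<And>u. u \<in> ?D \<Longrightarrow> ?le (G u) u \<Longrightarrow> ?le g u"
    "dlim ?D ?le UNIV (\<le>) (\<lambda>n. (G ^^ n) bottom) g"
    using least_fixed_point[OF dcpo_Dom bottom_Dom bottom_le G] by blast
  have "fixv Args (TFun t1 t2) G = g"
    unfolding fixv_def
  proof (rule the_equality)
    show "g \<in> ?D \<and> G g = g \<and> (\<forall>h\<in>?D. G h = h \<longrightarrow> ?le g h)"
      using g(1-3) po_refl[OF po_Dom] by metis
    show "h = g" if "h \<in> ?D \<and> G h = h \<and> (\<forall>k\<in>?D. G k = k \<longrightarrow> ?le h k)" for h
      using that g(1-3) po_refl[OF po_Dom] po_antisym[OF po_Dom] by metis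
  qed
  then show "fixv Args (TFun t1 t2) G \<in> ?D" "G (fixv Args (TFun t1 t2) G) = fixv Args (TFun t1 t2) G"
    "\<And>u. u \<in> ?D \<Longrightarrow> ?le (G u) u \<Longrightarrow> ?le (fixv Args (TFun t1 t2) G) u"
    "dlim ?D ?le UNIV (\<le>) (\<lambda>n. (G ^^ n) bottom) (fixv Args (TFun t1 t2) G)"
    using g by simp_all
qed

end

end

section \<open>Soundness and continuity of the semantics\<close>

text \<open>The eager and the stack semantics are both instances: a state is a pair \<open>(n, P)\<close> or a
  nonempty stack, \<open>enter s x\<close> is the state in which a closure created in state \<open>s\<close> runs when called
  with \<open>x\<close>, and \<open>arg s\<close> is what a call in state \<open>s\<close> passes to the callee.\<close>
locale semantics = arguments Args name
  for Args :: "'a set" and name :: "'a \<Rightarrow> ('n, 'p) stack" +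
  fixes V :: "'s set" and enter :: "'s \<Rightarrow> 'a \<Rightarrow> 's" and arg :: "'s \<Rightarrow> 'a"
    and sign :: "'n \<Rightarrow> 's \<Rightarrow> 's" and dopriv :: "'p \<Rightarrow> 's \<Rightarrow> 's" and chk :: "'p \<Rightarrow> 's \<Rightarrow> bool"
    and sem :: "tenv \<Rightarrow> ('n, 'p) exp \<Rightarrow> 's \<Rightarrow> (vname \<Rightarrow> ('n, 'p) univ) \<Rightarrow> ('n, 'p) univ res"
  assumes enter_V: "s \<in> V \<Longrightarrow> a \<in> Args \<Longrightarrow> enter s a \<in> V"
    and arg_Args: "s \<in> V \<Longrightarrow> arg s \<in> Args"
    and sign_V: "s \<in> V \<Longrightarrow> sign n s \<in> V"
    and dopriv_V: "s \<in> V \<Longrightarrow> dopriv p s \<in> V"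
    and sem_True: "s \<in> V \<Longrightarrow> sem D ETrue s h = RV (boolenc True)"
    and sem_Var: "s \<in> V \<Longrightarrow> sem D (EVar x) s h = RV (h x)"
    and sem_If: "s \<in> V \<Longrightarrow> sem D (EIf e e1 e2) s h =
      rbind (sem D e s h) (\<lambda>b. if b = boolenc True then sem D e1 s h else sem D e2 s h)"
    and sem_Lam: "s \<in> V \<Longrightarrow> typeof (D(x \<mapsto> t1)) e = Some t2 \<Longrightarrow> sem D (ELam x t1 e) s h =
      RV (mkfun Args t1 t2 (\<lambda>x' d. sem (D(x \<mapsto> t1)) e (enter s x') (h(x := d))))"
    and sem_App: "s \<in> V \<Longrightarrow> typeof D e1 = Some (TFun t1 t2) \<Longrightarrow> sem D (EApp e1 e2) s h =
      rbind (sem D e1 s h) (\<lambda>f. rbind (sem D e2 s h) (appv Args t1 t2 f (arg s)))"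
    and sem_Letrec: "s \<in> V \<Longrightarrow> sem D (ELetrec f x t1 t2 e1 e2) s h =
      sem (D(f \<mapsto> TFun t1 t2)) e2 s (h(f := fixv Args (TFun t1 t2) (\<lambda>g. mkfun Args t1 t2
        (\<lambda>x' d. sem (D(f \<mapsto> TFun t1 t2, x \<mapsto> t1)) e1 (enter s x') (h(f := g, x := d))))))"
    and sem_Signs: "s \<in> V \<Longrightarrow> sem D (ESigns n e) s h = sem D e (sign n s) h"
    and sem_Dopriv: "s \<in> V \<Longrightarrow> sem D (EDopriv p e) s h = sem D e (dopriv p s) h"
    and sem_Check: "s \<in> V \<Longrightarrow> sem D (ECheck p e) s h = (if chk p s then sem D e s h else RStar)"
    and sem_Test: "s \<in> V \<Longrightarrow> sem D (ETest p e1 e2) s h = (if chk p s then sem D e1 s h else sem D e2 s h)"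

text \<open>The semantics branches on \<open>typeof\<close>; for typable expressions this excludes
  the default \<open>RBot\<close>.\<close>

lemma typeof_has_type: "has_type D e t \<Longrightarrow> typeof D e = Some t"
  by (induction rule: has_type.induct) (simp_all del: fun_upd_apply)

context semantics
begin

abbreviation "vlim t \<equiv> dlim (Dom t) (Le t)"

text \<open>Convergence of environments at the variables of \<open>D\<close>; elsewhere they hold
  arbitrary values.\<close>

definition elim :: "tenv \<Rightarrow> 'i set \<Rightarrow> ('i \<Rightarrow> 'i \<Rightarrow> bool) \<Rightarrow> ('i \<Rightarrow> vname \<Rightarrow> ('n, 'p) univ) \<Rightarrow> (vname \<Rightarrow> ('n, 'p) univ) \<Rightarrow> bool" where
  "elim D I r hs h \<longleftrightarrow> (\<forall>x t. D x = Some t \<longrightarrow> vlim t I r (\<lambda>i. hs i x) (h x))"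

definition env :: "tenv \<Rightarrow> (vname \<Rightarrow> ('n, 'p) univ) \<Rightarrow> bool" where
  "env D h \<longleftrightarrow> (\<forall>x t. D x = Some t \<longrightarrow> h x \<in> Dom t)"

lemma elim_env: "elim D I r hs h \<Longrightarrow> env D h" "elim D I r hs h \<Longrightarrow> i \<in> I \<Longrightarrow> env D (hs i)"
  unfolding elim_def env_def using dlim_in dlim_mem by metis+

lemma elim_const: "dir I r \<Longrightarrow> env D h \<Longrightarrow> elim D I r (\<lambda>_. h) h"
  unfolding elim_def env_def by (simp add: dlim_const[OF po_Dom])

lemma env_upd: "env D h \<Longrightarrow> d \<in> Dom t \<Longrightarrow> env (D(x \<mapsto> t)) (h(x := d))"
  unfolding env_def by simp

lemma elim_upd:
  "elim D I r hs h \<Longrightarrow> vlim t I r ds d \<Longrightarrow> elim (D(x \<mapsto> t)) I r (\<lambda>i. (hs i)(x := ds i)) (h(x := d))"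
  unfolding elim_def by simp

text \<open>The index type must be fixed before the induction on typing derivations; semantic values
  serve as indices, since continuity of a closure body takes limits over directed sets of these.\<close>
definition sem_cont :: "tenv \<Rightarrow> ('n, 'p) exp \<Rightarrow> ty \<Rightarrow> bool" where
  "sem_cont D e t \<longleftrightarrow> (\<forall>s (I :: ('n, 'p) univ set) r hs h. s \<in> V \<longrightarrow> dir I r \<longrightarrow> elim D I r hs h \<longrightarrow>
     rlim t I r (\<lambda>i. sem D e s (hs i)) (sem D e s h))"

lemma sem_contD:
  fixes I :: "('n, 'p) univ set"
  assumes "sem_cont D e t" "s \<in> V" "dir I r" "elim D I r hs h"
  shows "rlim t I r (\<lambda>i. sem D e s (hs i)) (sem D e s h)"
  using assms unfolding sem_cont_def by blast

text \<open>Type soundness is the case of a constant family over a one-point index, since limits lie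
  in the domain.\<close>

lemma sem_cont_mem:
  assumes "sem_cont D e t" "s \<in> V" "env D h"
  shows "sem D e s h \<in> lift (Dom t)"
proof -
  have dir: "dir {undefined :: ('n, 'p) univ} (\<lambda>_ _. True)" by (simp add: dir_def)
  show ?thesis using dlim_in[OF sem_contD[OF assms(1,2) dir elim_const[OF dir assms(3)]]] .
qed

lemma body_cont:
  assumes e: "sem_cont (D(x \<mapsto> t1)) e t2" and s: "s \<in> V" and h: "env D h"
  shows "cont (Dom t1) (Le t1) (lift (Dom t2)) (rle (Le t2)) (\<lambda>d. sem (D(x \<mapsto> t1)) e s (h(x := d)))"
proof (rule contI)
  show "sem (D(x \<mapsto> t1)) e s (h(x := d)) \<in> lift (Dom t2)" if "d \<in> Dom t1" for d
    using sem_cont_mem[OF e s env_upd[OF h that]] .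
  show "rlim t2 X (Le t1) (\<lambda>d. sem (D(x \<mapsto> t1)) e s (h(x := d))) (sem (D(x \<mapsto> t1)) e s (h(x := l)))"
    if "dir X (Le t1)" "vlim t1 X (Le t1) (\<lambda>x. x) l" for X l
    using sem_contD[OF e s that(1) elim_upd[OF elim_const[OF that(1) h] that(2)]] .
qed

lemma body_bodies:
  assumes "sem_cont (D(x \<mapsto> t1)) e t2" "s \<in> V" "env D h"
  shows "(\<lambda>x' d. sem (D(x \<mapsto> t1)) e (enter s x') (h(x := d))) \<in> bodies t1 t2"
  unfolding bodies_def using body_cont[OF assms(1) enter_V[OF assms(2)] assms(3)] by simp

lemma closure_lim:
  fixes I :: "('n, 'p) univ set"
  assumes e: "sem_cont (D(x \<mapsto> t1)) e t2" and s: "s \<in> V" and I: "dir I r" and h: "elim D I r hs h"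
  shows "vlim (TFun t1 t2) I r
    (\<lambda>i. mkfun Args t1 t2 (\<lambda>x' d. sem (D(x \<mapsto> t1)) e (enter s x') ((hs i)(x := d))))
    (mkfun Args t1 t2 (\<lambda>x' d. sem (D(x \<mapsto> t1)) e (enter s x') (h(x := d))))"
proof (rule mkfun_dlim)
  show "(\<lambda>x' d. sem (D(x \<mapsto> t1)) e (enter s x') ((hs i)(x := d))) \<in> bodies t1 t2" if "i \<in> I" for i
    using body_bodies[OF e s elim_env(2)[OF h that]] .
  show "(\<lambda>x' d. sem (D(x \<mapsto> t1)) e (enter s x') (h(x := d))) \<in> bodies t1 t2"
    using body_bodies[OF e s elim_env(1)[OF h]] .
  show "rlim t2 I r (\<lambda>i. sem (D(x \<mapsto> t1)) e (enter s x') ((hs i)(x := d))) (sem (D(x \<mapsto> t1)) e (enter s x') (h(x := d)))"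
    if "x' \<in> Args" "d \<in> Dom t1" for x' d
    using sem_contD[OF e enter_V[OF s that(1)] I elim_upd[OF h dlim_const[OF po_Dom I that(2)]]] .
qed

text \<open>The environment stays an argument of the functional, because its fixed point is studied
  as the environment varies.\<close>

definition rec_step :: "tenv \<Rightarrow> vname \<Rightarrow> vname \<Rightarrow> ty \<Rightarrow> ty \<Rightarrow> ('n, 'p) exp \<Rightarrow> 's \<Rightarrow> (vname \<Rightarrow> ('n, 'p) univ)
    \<Rightarrow> ('n, 'p) univ \<Rightarrow> ('n, 'p) univ" where
  "rec_step D f x t1 t2 e s h g = mkfun Args t1 t2
     (\<lambda>x' d. sem (D(f \<mapsto> TFun t1 t2, x \<mapsto> t1)) e (enter s x') (h(f := g, x := d)))"

section \<open>Continuity of recursion in the environment\<close>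

context
  fixes D f x t1 t2 e s
  assumes e: "sem_cont (D(f \<mapsto> TFun t1 t2, x \<mapsto> t1)) e t2" and s: "s \<in> V"
begin

abbreviation (input) "T \<equiv> TFun t1 t2"
abbreviation (input) "G \<equiv> rec_step D f x t1 t2 e s"
abbreviation (input) "fix_G h \<equiv> fixv Args (TFun t1 t2) (rec_step D f x t1 t2 e s h)"

lemma rec_step_lim:
  fixes I :: "('n, 'p) univ set"
  assumes "dir I r" "elim D I r hs h" "vlim T I r gs g"
  shows "vlim T I r (\<lambda>i. G (hs i) (gs i)) (G h g)"
  unfolding rec_step_def by (rule closure_lim[OF e s assms(1) elim_upd[OF assms(2,3)]])

lemma rec_step_bodies:
  assumes "env D h" "g \<in> Dom T"
  shows "(\<lambda>x' d. sem (D(f \<mapsto> T, x \<mapsto> t1)) e (enter s x') (h(f := g, x := d))) \<in> bodies t1 t2"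
  by (rule body_bodies[OF e s env_upd[OF assms]])

lemma rec_step_Dom: "env D h \<Longrightarrow> g \<in> Dom T \<Longrightarrow> G h g \<in> Dom T"
  unfolding rec_step_def by (rule mkfun_Dom[OF rec_step_bodies])

lemma rec_step_cont: "env D h \<Longrightarrow> cont (Dom T) (Le T) (Dom T) (Le T) (G h)"
  by (intro contI rec_step_lim elim_const rec_step_Dom)

text \<open>Let \<open>l\<close> be the limit of the fixed points along \<open>hs\<close>. Joint
  continuity of the functional in environment and function makes \<open>l\<close> a fixed point at
  \<open>h\<close>, so \<open>fix_G h\<close> is below \<open>l\<close>. Conversely
  \<open>fix_G h\<close> is a prefixed point of every \<open>G (hs i)\<close>, so it bounds all
  their fixed points.\<close>

lemma fix_lim:
  fixes I :: "('n, 'p) univ set"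
  assumes I: "dir I r" and h: "elim D I r hs h"
  shows "vlim T I r (\<lambda>i. fix_G (hs i)) (fix_G h)"
proof -
  note ci = rec_step_cont[OF elim_env(2)[OF h]] and c = rec_step_cont[OF elim_env(1)[OF h]]
  have const: "vlim T I r (\<lambda>i. G (hs i) g) (G h g)" if "g \<in> Dom T" for g
    using rec_step_lim[OF I h dlim_const[OF po_Dom I that]] .
  have mono: "Le T (fix_G (hs i)) (fix_G (hs j))" if "i \<in> I" "j \<in> I" "r i j" for i j
    using fixv_least[OF ci[OF that(1)] fixv_Dom[OF ci[OF that(2)]]]
      dlim_mono[OF const[OF fixv_Dom[OF ci[OF that(2)]]] that] fixv_eq[OF ci[OF that(2)]] by simp
  obtain l where l: "vlim T I r (\<lambda>i. fix_G (hs i)) l"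
    by (rule dcpo_dlim[where f = "\<lambda>i. fix_G (hs i)", OF dcpo_Dom I fixv_Dom[OF ci] mono])
  have lD: "l \<in> Dom T" using dlim_in[OF l] .
  have "G (hs i) (fix_G (hs i)) = fix_G (hs i)" if "i \<in> I" for i
    using fixv_eq[OF ci[OF that]] .
  then have "vlim T I r (\<lambda>i. fix_G (hs i)) (G h l)"
    using rec_step_lim[OF I h l] dlim_cong[of I "\<lambda>i. G (hs i) (fix_G (hs i))" "\<lambda>i. fix_G (hs i)"] by simp
  then have "G h l = l" using dlim_unique[OF po_Dom _ l] by blast
  then have 1: "Le T (fix_G h) l" using fixv_least[OF c lD] po_refl[OF po_Dom lD] by simp
  have 2: "Le T l (fix_G h)"
  proof (rule dlim_least[OF l fixv_Dom[OF c]])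
    fix i assume i: "i \<in> I"
    show "Le T (fix_G (hs i)) (fix_G h)"
      using fixv_least[OF ci[OF i] fixv_Dom[OF c]] dlim_le[OF const[OF fixv_Dom[OF c]] i] fixv_eq[OF c]
      by simp
  qed
  have "l = fix_G h" using po_antisym[OF po_Dom 2 1 lD fixv_Dom[OF c]] .
  then show ?thesis using l by simp
qed

end

text \<open>Value and continuation both move with the index, hence the diagonal: the rows vary the
  continuation and the outer limit varies the value.\<close>

lemma rbind_lim:
  fixes I :: "'i set"
  assumes I: "dir I r" and m: "rlim t1 I r ms m"
    and k: "\<And>i. i \<in> I \<Longrightarrow> cont (Dom t1) (Le t1) (lift (Dom t2)) (rle (Le t2)) (ks i)"
    and k': "cont (Dom t1) (Le t1) (lift (Dom t2)) (rle (Le t2)) k"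
    and lim: "\<And>d. d \<in> Dom t1 \<Longrightarrow> rlim t2 I r (\<lambda>i. ks i d) (k d)"
  shows "rlim t2 I r (\<lambda>i. rbind (ms i) (ks i)) (rbind m k)"
proof (rule dlim_diag[where F = "\<lambda>i j. rbind (ms i) (ks j)", OF I po_lift_Dom])
  show "rlim t2 I r (\<lambda>i. rbind (ms i) k) (rbind m k)"
    using cont_dlim[OF cont_rbind[OF k' po_Dom po_Dom] po_lift_Dom I m] .
  show "rlim t2 I r (\<lambda>j. rbind (ms i) (ks j)) (rbind (ms i) k)" if "i \<in> I" for i
    using dlim_mem[OF m that] lim by (cases "ms i") (simp_all add: dlim_const[OF po_lift_Dom I])
  show "rle (Le t2) (rbind (ms i) (ks j)) (rbind (ms i') (ks j))"
    if "i \<in> I" "i' \<in> I" "j \<in> I" "r i i'" for i i' j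
    using cont_mono[OF cont_rbind[OF k[OF that(3)] po_Dom po_Dom] po_lift_Dom
        dlim_mono[OF m that(1,2,4)] dlim_mem[OF m that(1)] dlim_mem[OF m that(2)]] .
qed

text \<open>Directed sets of truth values are singletons, so continuity is automatic; this disposes
  of the branching in conditionals.\<close>

lemma cont_TBool:
  assumes "\<And>b. b \<in> Dom TBool \<Longrightarrow> k b \<in> lift (Dom t)"
  shows "cont (Dom TBool) (Le TBool) (lift (Dom t)) (rle (Le t)) k"
  unfolding cont_def
proof (intro conjI ballI allI impI assms)
  fix X l assume X: "directed (Dom TBool) (Le TBool) X \<and> is_lub (Dom TBool) (Le TBool) X l"
  then have l: "l \<in> Dom TBool" and ne: "X \<noteq> {}" and "\<forall>x\<in>X. x = l"
    by (simp_all add: directed_def is_lub_def dom.simps)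
  then have "X \<subseteq> {l}" by (simp add: subset_iff)
  then have "X = {l}" using ne subset_singletonD by metis
  then show "is_lub (lift (Dom t)) (rle (Le t)) (k ` X) (k l)"
    using assms[OF l] po_refl[OF po_lift_Dom] by (simp add: is_lub_def)
qed

lemma sem_If_lim:
  fixes I :: "('n, 'p) univ set"
  assumes s: "s \<in> V" and I: "dir I r" and h: "elim D I r hs h"
    and e: "sem_cont D e TBool" "sem_cont D e1 t" "sem_cont D e2 t"
  shows "rlim t I r (\<lambda>i. sem D (EIf e e1 e2) s (hs i)) (sem D (EIf e e1 e2) s h)"
  unfolding sem_If[OF s]
proof (rule rbind_lim[OF I sem_contD[OF e(1) s I h]])
  note L1 = sem_contD[OF e(2) s I h] and L2 = sem_contD[OF e(3) s I h]
  show "cont (Dom TBool) (Le TBool) (lift (Dom t)) (rle (Le t))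
      (\<lambda>b. if b = boolenc True then sem D e1 s (hs i) else sem D e2 s (hs i))" if "i \<in> I" for i
    by (rule cont_TBool) (simp add: dlim_mem[OF L1 that] dlim_mem[OF L2 that])
  show "cont (Dom TBool) (Le TBool) (lift (Dom t)) (rle (Le t))
      (\<lambda>b. if b = boolenc True then sem D e1 s h else sem D e2 s h)"
    by (rule cont_TBool) (simp add: dlim_in[OF L1] dlim_in[OF L2])
  show "rlim t I r (\<lambda>i. if b = boolenc True then sem D e1 s (hs i) else sem D e2 s (hs i))
      (if b = boolenc True then sem D e1 s h else sem D e2 s h)" for b
    using L1 L2 by simp
qed

lemma rbind_appv_cont:
  assumes "m \<in> lift (Dom t1)" "x \<in> Args"
  shows "cont (Dom (TFun t1 t2)) (Le (TFun t1 t2)) (lift (Dom t2)) (rle (Le t2)) (\<lambda>f. rbind m (appv Args t1 t2 f x))"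
  using assms by (cases m) (simp_all add: cont_const[OF po_lift_Dom] cont_appv_fun)

lemma sem_App_lim:
  fixes I :: "('n, 'p) univ set"
  assumes s: "s \<in> V" and I: "dir I r" and h: "elim D I r hs h"
    and ty: "typeof D e1 = Some (TFun t1 t2)" and e: "sem_cont D e1 (TFun t1 t2)" "sem_cont D e2 t1"
  shows "rlim t2 I r (\<lambda>i. sem D (EApp e1 e2) s (hs i)) (sem D (EApp e1 e2) s h)"
  unfolding sem_App[OF s ty]
proof (rule rbind_lim[OF I sem_contD[OF e(1) s I h]])
  note L2 = sem_contD[OF e(2) s I h] and a = arg_Args[OF s]
  show "cont (Dom (TFun t1 t2)) (Le (TFun t1 t2)) (lift (Dom t2)) (rle (Le t2))
      (\<lambda>f. rbind (sem D e2 s (hs i)) (appv Args t1 t2 f (arg s)))" if "i \<in> I" for i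
    by (rule rbind_appv_cont[OF dlim_mem[OF L2 that] a])
  show "cont (Dom (TFun t1 t2)) (Le (TFun t1 t2)) (lift (Dom t2)) (rle (Le t2))
      (\<lambda>f. rbind (sem D e2 s h) (appv Args t1 t2 f (arg s)))"
    by (rule rbind_appv_cont[OF dlim_in[OF L2] a])
  show "rlim t2 I r (\<lambda>i. rbind (sem D e2 s (hs i)) (appv Args t1 t2 f (arg s)))
      (rbind (sem D e2 s h) (appv Args t1 t2 f (arg s)))" if "f \<in> Dom (TFun t1 t2)" for f
    using cont_dlim[OF cont_rbind[OF cont_appv[OF that a] po_Dom po_Dom] po_lift_Dom I L2] .
qed

lemma sem_cont: "has_type D e t \<Longrightarrow> sem_cont D e t"
proof (induction rule: has_type.induct)
  case (T_True D)
  have "boolenc True \<in> Dom TBool" by (simp add: dom.simps)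
  then show ?case unfolding sem_cont_def by (simp add: sem_True dlim_const[OF po_lift_Dom])
next
  case (T_Var D x t)
  then show ?case unfolding sem_cont_def by (simp add: sem_Var elim_def dlim_RV[OF _ po_Dom])
next
  case (T_If D e e1 t e2)
  then show ?case using sem_If_lim unfolding sem_cont_def[of D "EIf e e1 e2"] by blast
next
  case (T_Lam D x t1 e t2)
  then show ?case unfolding sem_cont_def[of D "ELam x t1 e"]
    using dlim_RV[OF _ po_Dom closure_lim[OF T_Lam.IH]]
    by (simp add: sem_Lam[OF _ typeof_has_type[OF T_Lam.hyps]])
next
  case (T_App D e1 t1 t2 e2)
  then show ?case
    using sem_App_lim typeof_has_type unfolding sem_cont_def[of D "EApp e1 e2"] by blast
next
  case (T_Letrec D f t1 t2 x e1 e2 t)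
  show ?case unfolding sem_cont_def
  proof (intro allI impI)
    fix s and I :: "('n, 'p) univ set" and r hs h
    assume s: "s \<in> V" and I: "dir I r" and h: "elim D I r hs h"
    show "rlim t I r (\<lambda>i. sem D (ELetrec f x t1 t2 e1 e2) s (hs i)) (sem D (ELetrec f x t1 t2 e1 e2) s h)"
      using sem_contD[OF T_Letrec.IH(2) s I elim_upd[OF h fix_lim[OF T_Letrec.IH(1) s I h]]]
      unfolding rec_step_def[abs_def] sem_Letrec[OF s] .
  qed
qed (simp_all add: sem_cont_def sem_Signs sign_V sem_Dopriv dopriv_V sem_Check sem_Test dlim_const[OF po_lift_Dom])

end

section \<open>The logical relation\<close>

text \<open>\<open>rel_res\<close> forces the same constructor at each index, so both families fall
  into the same case of \<open>dlim_lift_cases\<close> and leave \<open>RBot\<close> on the same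
  index set. As that set may be smaller than \<open>I\<close>, admissibility is asked for every
  directed \<open>J\<close>.\<close>

lemma rel_res_lim:
  assumes I: "dir I r" and A: "po A leA" and B: "po B leB"
    and m: "dlim (lift A) (rle leA) I r ms m" and n: "dlim (lift B) (rle leB) I r ns n"
    and Q: "\<And>i. i \<in> I \<Longrightarrow> rel_res Q (ms i) (ns i)"
    and adm: "\<And>J ds d ds' d'. dir J r \<Longrightarrow> dlim A leA J r ds d \<Longrightarrow> dlim B leB J r ds' d' \<Longrightarrow>
      (\<And>i. i \<in> J \<Longrightarrow> Q (ds i) (ds' i)) \<Longrightarrow> Q d d'"
  shows "rel_res Q m n"
proof -
  have bot: "ms i = RBot \<longleftrightarrow> ns i = RBot" and star: "ms i = RStar \<longleftrightarrow> ns i = RStar" if "i \<in> I" for i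
    using Q[OF that] by (cases "ms i"; cases "ns i"; simp)+
  have J: "{i \<in> I. ns i \<noteq> RBot} = {i \<in> I. ms i \<noteq> RBot}" using bot by blast
  have star_m: "m = RStar" if "i \<in> I" "ms i = RStar" for i using dlim_le[OF m that(1)] that(2) by simp
  have star_n: "n = RStar" if "i \<in> I" "ns i = RStar" for i using dlim_le[OF n that(1)] that(2) by simp
  show ?thesis
    using dlim_lift_cases[OF I A m]
  proof (elim disjE exE conjE)
    assume *: "m = RBot" "\<forall>i\<in>I. ms i = RBot"
    have "rle leB n RBot" by (rule dlim_least[OF n]) (use * bot in auto)
    then show ?thesis using * by simp
  next
    assume "m = RStar" "\<exists>i\<in>I. ms i = RStar"
    then show ?thesis using star star_n by fastforce
  next
    fix a d
    let ?J = "{i \<in> I. ms i \<noteq> RBot}"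
    assume m': "m = RV a" and J': "dir ?J r" and d: "dlim A leA ?J r d a"
      and ms: "\<forall>i\<in>I. ms i \<noteq> RBot \<longrightarrow> ms i = RV (d i)"
    obtain j where j: "j \<in> I" "ms j \<noteq> RBot" using J' unfolding dir_def by blast
    show ?thesis
      using dlim_lift_cases[OF I B n]
    proof (elim disjE exE conjE)
      assume "\<forall>i\<in>I. ns i = RBot"
      then show ?thesis using j bot by simp
    next
      assume "\<exists>i\<in>I. ns i = RStar"
      then show ?thesis using m' star star_m by fastforce
    next
      fix b d'
      assume n': "n = RV b" and d': "dlim B leB {i \<in> I. ns i \<noteq> RBot} r d' b"
        and ns: "\<forall>i\<in>I. ns i \<noteq> RBot \<longrightarrow> ns i = RV (d' i)"
      have "Q (d i) (d' i)" if "i \<in> ?J" for i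
        using Q[of i] ms ns bot that by (metis (mono_tags, lifting) mem_Collect_eq res.rel_inject)
      then have "Q a b" using adm[OF J' d] d' J by simp
      then show ?thesis using m' n' by simp
    qed
  qed
qed

lemma rel_res_rbind:
  assumes "rel_res Q m n" "\<And>d d'. Q d d' \<Longrightarrow> rel_res Q' (k d) (k' d')"
  shows "rel_res Q' (rbind m k) (rbind n k')"
  using assms by (cases m; cases n) simp_all

lemma in_privs: "p \<in> privs ACL S \<longleftrightarrow> check ACL p S"
  by (simp add: privs_def)

text \<open>A fresh frame enables nothing itself and only filters by \<open>p \<in> ACL n\<close>,
  which is the eager intersection. With \<open>privs_dopriv\<close> this says that both semantics
  change state in step.\<close>

lemma privs_sign: "privs ACL ((n, {}) # S) = privs ACL S \<inter> ACL n"
  by (auto simp: privs_def)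

lemma privs_dopriv: "privs ACL ((n, insert p P) # S) = join_priv ACL n (privs ACL ((n, P) # S)) p"
  by (auto simp: privs_def join_priv_def)

text \<open>\<open>signs\<close> overwrites the current principal without reading it. This is how
  standardness enters the comparison.\<close>

lemma esem_is_signs: "is_signs e \<Longrightarrow> esem ACL D e n P h = esem ACL D e m P h"
  by (cases e) simp_all

locale access_control =
  fixes ACL :: "'n \<Rightarrow> 'p set"
begin

text \<open>Entering an eager closure keeps the principal of the creating state and takes the
  privileges of the caller; for stacks, the creating state is discarded altogether. The singleton
  stacks are chosen for injectivity, with an arbitrary principal.\<close>

sublocale E: semantics "PrivSets :: 'p set set" "\<lambda>P. [(undefined :: 'n, P)]"
  UNIV "\<lambda>(n, _) P. (n, P)" snd "\<lambda>n' (n, P). (n', P \<inter> ACL n')" "\<lambda>p (n, P). (n, join_priv ACL n P p)"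
  "\<lambda>p (n, P). p \<in> P" "\<lambda>D e (n, P). esem ACL D e n P"
  by unfold_locales (auto simp: inj_on_def)

sublocale S: semantics "Stacks :: ('n, 'p) stack set" "\<lambda>S. S"
  Stacks "\<lambda>_ S. S" "\<lambda>S. S" "\<lambda>n S. (n, {}) # S"
  "\<lambda>p S. case S of [] \<Rightarrow> [] | (n, P) # S' \<Rightarrow> (n, insert p P) # S'" "check ACL" "ssem ACL"
  by unfold_locales (auto simp: inj_on_def Stacks_def neq_Nil_conv)

text \<open>Eager functions are examined at sets of the form \<open>privs S\<close> and may do
  anything at others, such as sets containing a privilege granted to no principal. Domain membership
  is built in so that related values can be passed directly to the rules for application and
  limits.\<close>

primrec R :: "ty \<Rightarrow> ('n, 'p) univ \<Rightarrow> ('n, 'p) univ \<Rightarrow> bool" where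
  "R TBool u v \<longleftrightarrow> u = v \<and> u \<in> range boolenc"
| "R (TFun t1 t2) u v \<longleftrightarrow> u \<in> E.Dom (TFun t1 t2) \<and> v \<in> S.Dom (TFun t1 t2) \<and>
    (\<forall>S\<in>Stacks. \<forall>d d'. R t1 d d' \<longrightarrow>
      rel_res (R t2) (appv PrivSets t1 t2 u (privs ACL S) d) (appv Stacks t1 t2 v S d'))"

lemma R_Dom:
  assumes "R t u v"
  shows "u \<in> E.Dom t" "v \<in> S.Dom t"
proof -
  have "u \<in> E.Dom t \<and> v \<in> S.Dom t"
  proof (cases t)
    case TBool
    then have "u \<in> range boolenc" "v \<in> range boolenc" using assms by (metis R.simps(1))+
    then show ?thesis unfolding TBool dom.simps(1) fst_conv by blast
  next
    case (TFun t1 t2)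
    then show ?thesis using assms unfolding TFun R.simps by (elim conjE) (intro conjI)
  qed
  then show "u \<in> E.Dom t" "v \<in> S.Dom t" by blast+
qed

text \<open>Admissibility, by induction on the type: with the arguments fixed, application is
  continuous in the function, and \<open>rel_res_lim\<close> reduces the claim to the result type.
  The index set varies in the induction because \<open>rel_res_lim\<close> shrinks it.\<close>

lemma R_lim:
  assumes "dir I r" "E.vlim t I r us u" "S.vlim t I r vs v" "\<And>i. i \<in> I \<Longrightarrow> R t (us i) (vs i)"
  shows "R t u v"
  using assms
proof (induction t arbitrary: I us u vs v)
  case TBool
  then obtain i where i: "i \<in> I" by (auto simp: dir_def)
  then have "us i = u" "vs i = v"
    using dlim_le[OF TBool(2)] dlim_le[OF TBool(3)] by (simp_all add: dom.simps(1))
  with TBool(4)[OF i] show ?case by metis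
next
  case (TFun t1 t2)
  have "rel_res (R t2) (appv PrivSets t1 t2 u (privs ACL S) d) (appv Stacks t1 t2 v S d')"
    if S: "S \<in> Stacks" and d: "R t1 d d'" for S d d'
  proof (rule rel_res_lim[OF TFun.prems(1) E.po_Dom S.po_Dom])
    show "E.rlim t2 I r (\<lambda>i. appv PrivSets t1 t2 (us i) (privs ACL S) d) (appv PrivSets t1 t2 u (privs ACL S) d)"
      by (rule E.appv_dlim[OF TFun.prems(1,2) UNIV_I R_Dom(1)[OF d]])
    show "S.rlim t2 I r (\<lambda>i. appv Stacks t1 t2 (vs i) S d') (appv Stacks t1 t2 v S d')"
      by (rule S.appv_dlim[OF TFun.prems(1,3) S R_Dom(2)[OF d]])
    show "rel_res (R t2) (appv PrivSets t1 t2 (us i) (privs ACL S) d) (appv Stacks t1 t2 (vs i) S d')"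
      if "i \<in> I" for i using TFun.prems(4)[OF that] S d by simp
  qed (rule TFun.IH(2))
  then show ?case using dlim_in[OF TFun.prems(2)] dlim_in[OF TFun.prems(3)] by simp
qed

lemma R_mkfun:
  assumes b: "b \<in> E.bodies t1 t2" and b': "b' \<in> S.bodies t1 t2"
    and rel: "\<And>S d d'. S \<in> Stacks \<Longrightarrow> R t1 d d' \<Longrightarrow> rel_res (R t2) (b (privs ACL S) d) (b' S d')"
  shows "R (TFun t1 t2) (mkfun PrivSets t1 t2 b) (mkfun Stacks t1 t2 b')"
  unfolding R.simps
proof (intro conjI ballI allI impI E.mkfun_Dom[OF b] S.mkfun_Dom[OF b'])
  fix S :: "('n, 'p) stack" and d d' assume S: "S \<in> Stacks" and d: "R t1 d d'"
  show "rel_res (R t2) (appv PrivSets t1 t2 (mkfun PrivSets t1 t2 b) (privs ACL S) d)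
      (appv Stacks t1 t2 (mkfun Stacks t1 t2 b') S d')"
    unfolding E.appv_mkfun[OF b UNIV_I R_Dom(1)[OF d]] S.appv_mkfun[OF b' S R_Dom(2)[OF d]]
    by (rule rel[OF S d])
qed

section \<open>Related environments and the fundamental lemma\<close>

definition renv :: "tenv \<Rightarrow> (vname \<Rightarrow> ('n, 'p) univ) \<Rightarrow> (vname \<Rightarrow> ('n, 'p) univ) \<Rightarrow> bool" where
  "renv D h h' \<longleftrightarrow> (\<forall>x t. D x = Some t \<longrightarrow> R t (h x) (h' x))"

lemma renv_env: "renv D h h' \<Longrightarrow> E.env D h" "renv D h h' \<Longrightarrow> S.env D h'"
  unfolding renv_def E.env_def S.env_def using R_Dom by blast+

lemma renv_upd: "renv D h h' \<Longrightarrow> R t d d' \<Longrightarrow> renv (D(x \<mapsto> t)) (h(x := d)) (h'(x := d'))"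
  unfolding renv_def by simp

text \<open>The eager principal is tied to the top frame: \<open>signs\<close> sets both alike, and
  \<open>dopriv\<close> consults the one as authorisation while marking the frame of the
  other.\<close>

definition adequate :: "tenv \<Rightarrow> ('n, 'p) exp \<Rightarrow> ty \<Rightarrow> bool" where
  "adequate D e t \<longleftrightarrow> (\<forall>n P S h h'. renv D h h' \<longrightarrow>
     rel_res (R t) (esem ACL D e n (privs ACL ((n, P) # S)) h) (ssem ACL D e ((n, P) # S) h'))"

lemma adequateD:
  "adequate D e t \<Longrightarrow> renv D h h' \<Longrightarrow>
    rel_res (R t) (esem ACL D e n (privs ACL ((n, P) # S)) h) (ssem ACL D e ((n, P) # S) h')"
  unfolding adequate_def by blast

text \<open>In a standard program the principal in whose name a closure is created is irrelevant to its
  body, which is why the caller's stack alone determines the result of a call.\<close>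
lemma R_closure:
  assumes ty: "has_type (D(x \<mapsto> t1)) e t2" and signs: "is_signs e"
    and e: "adequate (D(x \<mapsto> t1)) e t2" and h: "renv D h h'"
  shows "R (TFun t1 t2) (mkfun PrivSets t1 t2 (\<lambda>P d. esem ACL (D(x \<mapsto> t1)) e n P (h(x := d))))
    (mkfun Stacks t1 t2 (\<lambda>S d. ssem ACL (D(x \<mapsto> t1)) e S (h'(x := d))))"
proof (rule R_mkfun)
  show "(\<lambda>P d. esem ACL (D(x \<mapsto> t1)) e n P (h(x := d))) \<in> E.bodies t1 t2"
    using E.body_bodies[OF E.sem_cont[OF ty] UNIV_I renv_env(1)[OF h], of "(n, {})"] by simp
  have "[(n, {})] \<in> Stacks" by (simp add: Stacks_def)
  then show "(\<lambda>S d. ssem ACL (D(x \<mapsto> t1)) e S (h'(x := d))) \<in> S.bodies t1 t2"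
    using S.body_bodies[OF S.sem_cont[OF ty] _ renv_env(2)[OF h]] by blast
  fix S :: "('n, 'p) stack" and d d' assume "S \<in> Stacks" and d: "R t1 d d'"
  then obtain m P S' where S: "S = (m, P) # S'" by (auto simp: Stacks_def neq_Nil_conv)
  \<comment> \<open>The closure was created under \<open>n\<close>, but the caller's stack is topped
    by \<open>m\<close>; exchanging the two restores the invariant of
    \<open>adequate\<close>.\<close>
  show "rel_res (R t2) (esem ACL (D(x \<mapsto> t1)) e n (privs ACL S) (h(x := d)))
      (ssem ACL (D(x \<mapsto> t1)) e S (h'(x := d')))"
    unfolding esem_is_signs[OF signs, of _ _ n _ _ m] S by (rule adequateD[OF e renv_upd[OF h d]])
qed

lemma R_fixv:
  fixes h h' :: "vname \<Rightarrow> ('n, 'p) univ"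
  assumes ty: "has_type (D(f \<mapsto> TFun t1 t2, x \<mapsto> t1)) e t2" and signs: "is_signs e"
    and e: "adequate (D(f \<mapsto> TFun t1 t2, x \<mapsto> t1)) e t2" and h: "renv D h h'"
  defines "G \<equiv> \<lambda>n g. mkfun PrivSets t1 t2
      (\<lambda>P d. esem ACL (D(f \<mapsto> TFun t1 t2, x \<mapsto> t1)) e n P (h(f := g, x := d)))"
    and "G' \<equiv> \<lambda>g. mkfun Stacks t1 t2
      (\<lambda>S d. ssem ACL (D(f \<mapsto> TFun t1 t2, x \<mapsto> t1)) e S (h'(f := g, x := d)))"
  shows "R (TFun t1 t2) (fixv (PrivSets :: 'p set set) (TFun t1 t2) (G n)) (fixv (Stacks :: ('n, 'p) stack set) (TFun t1 t2) G')"
proof (rule R_lim)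
  show "dir (UNIV :: nat set) (\<le>)"
    unfolding dir_def by (metis UNIV_I empty_iff nat_le_linear order_refl)
  \<comment> \<open>\<open>rec_step\<close> wants a creating state, of which only the principal
    matters here; the empty privilege set is a filler, as is the whole stack
    \<open>[(n, {})]\<close> below.\<close>
  have "G n = E.rec_step D f x t1 t2 e (n, {}) h"
    unfolding G_def by (simp add: fun_eq_iff E.rec_step_def)
  then show "E.vlim (TFun t1 t2) UNIV (\<le>) (\<lambda>k. (G n ^^ k) (E.bottom t1 t2)) (fixv (PrivSets :: 'p set set) (TFun t1 t2) (G n))"
    using E.fixv_dlim[OF E.rec_step_cont[OF E.sem_cont[OF ty] UNIV_I renv_env(1)[OF h]], of "(n, {})"]
    by (simp only:)
  have "[(n, {})] \<in> Stacks" by (simp add: Stacks_def)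
  moreover have "G' = S.rec_step D f x t1 t2 e [(n, {})] h'"
    unfolding G'_def by (simp add: fun_eq_iff S.rec_step_def)
  ultimately show "S.vlim (TFun t1 t2) UNIV (\<le>) (\<lambda>k. (G' ^^ k) (S.bottom t1 t2)) (fixv (Stacks :: ('n, 'p) stack set) (TFun t1 t2) G')"
    using S.fixv_dlim[OF S.rec_step_cont[OF S.sem_cont[OF ty] _ renv_env(2)[OF h]]] by simp
  show "R (TFun t1 t2) ((G n ^^ k) (E.bottom t1 t2)) ((G' ^^ k) (S.bottom t1 t2))" for k
  proof (induction k)
    case 0
    have "R (TFun t1 t2) (E.bottom t1 t2) (S.bottom t1 t2)"
      unfolding E.bottom_def S.bottom_def by (rule R_mkfun[OF E.RBot_bodies S.RBot_bodies]) simp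
    then show ?case by simp
  next
    case (Suc k)
    show ?case
      using R_closure[OF ty signs e renv_upd[OF h Suc], of n] unfolding G_def G'_def by simp
  qed
qed

text \<open>Fundamental lemma of the relation. State changes agree by \<open>privs_sign\<close> and
  \<open>privs_dopriv\<close>, tests consult the same set, and a call instantiates \<open>R\<close>
  at the current stack; binders are left to \<open>R_closure\<close> and
  \<open>R_fixv\<close>.\<close>

lemma adequacy: "has_type D e t \<Longrightarrow> standard e \<Longrightarrow> adequate D e t"
proof (induction rule: has_type.induct)
  case (T_Var D x t)
  then show ?case by (simp add: adequate_def renv_def)
next
  case (T_If D e e1 t e2)
  then have "adequate D e TBool" "adequate D e1 t" "adequate D e2 t" by simp_all
  then show ?case unfolding adequate_def esem.simps ssem.simps
    by (intro allI impI rel_res_rbind[where Q = "R TBool"]) simp_all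
next
  case (T_Lam D x t1 e t2)
  then have "is_signs e" "adequate (D(x \<mapsto> t1)) e t2" by (simp_all del: fun_upd_apply)
  then show ?case unfolding adequate_def[of D "ELam x t1 e"]
    using R_closure[OF T_Lam.hyps] typeof_has_type[OF T_Lam.hyps] by (simp del: R.simps fun_upd_apply)
next
  case (T_App D e1 t1 t2 e2)
  then have e: "adequate D e1 (TFun t1 t2)" "adequate D e2 t1" by simp_all
  show ?case unfolding adequate_def esem.simps ssem.simps typeof_has_type[OF T_App.hyps(1)] option.case ty.case
  proof (intro allI impI rel_res_rbind[OF adequateD[OF e(1)]] rel_res_rbind[OF adequateD[OF e(2)]])
    show "rel_res (R t2) (appv PrivSets t1 t2 u (privs ACL ((n, P) # S)) d) (appv Stacks t1 t2 v ((n, P) # S) d')"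
      if "R (TFun t1 t2) u v" "R t1 d d'" for n P S u v d d' using that by (simp add: Stacks_def)
  qed
next
  case (T_Letrec D f t1 t2 x e1 e2 t)
  then have e: "is_signs e1" "adequate (D(f \<mapsto> TFun t1 t2, x \<mapsto> t1)) e1 t2" "adequate (D(f \<mapsto> TFun t1 t2)) e2 t"
    by (simp_all del: fun_upd_apply)
  show ?case unfolding adequate_def esem.simps ssem.simps
    by (intro allI impI adequateD[OF e(3)] renv_upd R_fixv[OF T_Letrec.hyps(1) e(1,2)])
next
  case (T_Signs D e t n)
  then show ?case by (simp add: adequate_def privs_sign[symmetric])
next
  case (T_Dopriv D e t p)
  then show ?case by (simp add: adequate_def privs_dopriv[symmetric])
qed (simp_all add: adequate_def in_privs del: check.simps)

end

theorem theorem5: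
  fixes ACL :: "'n \<Rightarrow> 'p set" and e :: "('n, 'p) exp"
    and n :: 'n and P' :: "'p set" and S :: "('n, 'p) stack"
  assumes "standard e"
    and "has_type Map.empty e TBool"
  shows "esem ACL Map.empty e n (privs ACL ((n, P') # S)) emptyenv
         = ssem ACL Map.empty e ((n, P') # S) emptyenv"
proof -
  interpret access_control ACL .
  have "renv Map.empty emptyenv emptyenv" by (simp add: renv_def)
  then have "rel_res (R TBool) (esem ACL Map.empty e n (privs ACL ((n, P') # S)) emptyenv)
      (ssem ACL Map.empty e ((n, P') # S) emptyenv)"
    using adequateD[OF adequacy[OF assms(2,1)]] by blast
  \<comment> \<open>At base type \<open>R\<close> is contained in equality, so relatedness of
    results becomes equality, divergence and error included.\<close>
  then have "rel_res (=) (esem ACL Map.empty e n (privs ACL ((n, P') # S)) emptyenv)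
      (ssem ACL Map.empty e ((n, P') # S) emptyenv)"
    by (rule res.rel_mono_strong) simp
  then show ?thesis by (simp add: res.rel_eq)
qed

end
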